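(* Assume $|v(x)|\lesssim\langle x\rangle^{-2-}$. If $\phi\in S_1L^2(\mathbb R^4)\setminus\{0\}$, then $\phi=Uv\psi$, where $\psi\in L^\infty(\mathbb R^4)$, $H\psi=0$ in the sense of distributions, and $$\psi=c_0-G_1v\phi,\qquad c_0=\frac1{\|V\|_{L^1}}\langle v,T\phi\rangle=\frac1{\|V\|_{L^1}}\int_{\mathbb R^4}v(x)\,(T\phi)(x)\,dx .$$ Moreover, if $|v(x)|\lesssim\langle x\rangle^{-3-}$, then $G_1v\phi\in L^p(\mathbb R^4)$ for all $4<p\le\infty$.
   Context: $V:\mathbb R^4\to\mathbb R$ is a real-valued potential, not a.e. zero, and $H=(-\Delta)^2+V$. $U(x)=1$ if $V(x)\ge0$ and $U(x)=-1$ if $V(x)<0$; $v=|V|^{1/2}$. $\langle x\rangle=(1+|x|^2)^{1/2}$, and $|v(x)|\lesssim\langle x\rangle^{-a-}$ means $|v(x)|\le C\langle x\rangle^{-a-\epsilon}$ for some $C,\epsilon>0$. $P$ is the orthogonal projection in $L^2(\mathbb R^4)$ onto the span of $v$, $Q=1-P$. $G_1f(x)=-\frac1{8\pi^2}\int_{\mathbb R^4}\log|x-y|\,f(y)\,dy$. $T=U+vG_1v$ ($U$ and $v$ acting by multiplication). $S_1$ is the Riesz (orthogonal) projection onto the kernel of $QTQ$ on $QL^2$. *)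

theory Defs
  imports "HOL-Analysis.Analysis"
begin

(* Elements of the Lebesgue spaces on R^4 are represented by honest functions, so that equality
   of such elements is equality almost everywhere with respect to Lebesgue measure. *)

type_synonym R4 = "real^4"

abbreviation ae_eq :: "(R4 \<Rightarrow> complex) \<Rightarrow> (R4 \<Rightarrow> complex) \<Rightarrow> bool"  (infix "=ae" 50)
  where "f =ae g \<equiv> AE x in lebesgue. f x = g x"

(* Meaningful for 1 \<le> p \<le> \<infinity>. *)
definition Lp :: "ennreal \<Rightarrow> (R4 \<Rightarrow> complex) set"
  where "Lp p = {f \<in> borel_measurable lebesgue.
           if p = \<infinity> then \<exists>C::real. AE x in lebesgue. norm (f x) \<le> C
           else integrable lebesgue (\<lambda>x. norm (f x) powr enn2real p)}"

definition ip :: "(R4 \<Rightarrow> complex) \<Rightarrow> (R4 \<Rightarrow> complex) \<Rightarrow> complex"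
  where "ip f g = (LINT x|lebesgue. cnj (f x) * g x)"

(* E is the orthogonal projection of L^2 onto the subspace M; E f is determined only a.e. *)
definition orthogonal_projection ::
    "((R4 \<Rightarrow> complex) \<Rightarrow> (R4 \<Rightarrow> complex)) \<Rightarrow> (R4 \<Rightarrow> complex) set \<Rightarrow> bool"
  where "orthogonal_projection E M \<longleftrightarrow>
           (\<forall>f\<in>Lp 2. E f \<in> M \<and> (\<forall>g\<in>M. ip g (\<lambda>x. f x - E f x) = 0))"

(* The subspace E L^2, closed under a.e. equality. *)
definition range_L2 :: "((R4 \<Rightarrow> complex) \<Rightarrow> (R4 \<Rightarrow> complex)) \<Rightarrow> (R4 \<Rightarrow> complex) set"
  where "range_L2 E = {f \<in> Lp 2. \<exists>g\<in>Lp 2. f =ae E g}"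

definition jap :: "R4 \<Rightarrow> real"
  where "jap x = sqrt (1 + (norm x)\<^sup>2)"

(* |w(x)| \<lesssim> \<langle>x\<rangle>^{-a-} *)
definition decays :: "real \<Rightarrow> (R4 \<Rightarrow> real) \<Rightarrow> bool"
  where "decays a w \<longleftrightarrow>
           (\<exists>C>0. \<exists>\<epsilon>>0. AE x in lebesgue. \<bar>w x\<bar> \<le> C * jap x powr (- a - \<epsilon>))"

definition pot_U :: "(R4 \<Rightarrow> real) \<Rightarrow> R4 \<Rightarrow> real"
  where "pot_U V x = (if V x \<ge> 0 then 1 else - 1)"

definition pot_v :: "(R4 \<Rightarrow> real) \<Rightarrow> R4 \<Rightarrow> real"
  where "pot_v V x = sqrt \<bar>V x\<bar>"

definition mult_op :: "(R4 \<Rightarrow> real) \<Rightarrow> (R4 \<Rightarrow> complex) \<Rightarrow> R4 \<Rightarrow> complex"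
  where "mult_op w f x = complex_of_real (w x) * f x"

definition G1 :: "(R4 \<Rightarrow> complex) \<Rightarrow> R4 \<Rightarrow> complex"
  where "G1 f x =
           - complex_of_real (1 / (8 * pi\<^sup>2)) *
             (LINT y|lebesgue. complex_of_real (ln (norm (x - y))) * f y)"

definition T_op :: "(R4 \<Rightarrow> real) \<Rightarrow> (R4 \<Rightarrow> complex) \<Rightarrow> R4 \<Rightarrow> complex"
  where "T_op V f x =
           mult_op (pot_U V) f x + mult_op (pot_v V) (G1 (mult_op (pot_v V) f)) x"

definition span_v :: "(R4 \<Rightarrow> real) \<Rightarrow> (R4 \<Rightarrow> complex) set"
  where "span_v V = {f \<in> Lp 2. \<exists>c. f =ae (\<lambda>x. c * complex_of_real (pot_v V x))}"

definition compl_proj ::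
    "((R4 \<Rightarrow> complex) \<Rightarrow> (R4 \<Rightarrow> complex)) \<Rightarrow> (R4 \<Rightarrow> complex) \<Rightarrow> R4 \<Rightarrow> complex"
  where "compl_proj P f x = f x - P f x"

(* The kernel of QTQ acting on Q L^2, where Q = 1 - P. *)
definition ker_QTQ ::
    "(R4 \<Rightarrow> real) \<Rightarrow> ((R4 \<Rightarrow> complex) \<Rightarrow> (R4 \<Rightarrow> complex)) \<Rightarrow> (R4 \<Rightarrow> complex) set"
  where "ker_QTQ V P =
           {f \<in> range_L2 (compl_proj P). compl_proj P (T_op V (compl_proj P f)) =ae (\<lambda>x. 0)}"

definition partial :: "R4 \<Rightarrow> (R4 \<Rightarrow> complex) \<Rightarrow> R4 \<Rightarrow> complex"
  where "partial i f x = frechet_derivative f (at x) i"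

primrec Ck :: "nat \<Rightarrow> (R4 \<Rightarrow> complex) \<Rightarrow> bool"
  where
    "Ck 0 f \<longleftrightarrow> continuous_on UNIV f"
  | "Ck (Suc k) f \<longleftrightarrow> (\<forall>x. f differentiable (at x)) \<and> (\<forall>i\<in>Basis. Ck k (partial i f))"

definition test_function :: "(R4 \<Rightarrow> complex) \<Rightarrow> bool"
  where "test_function \<eta> \<longleftrightarrow> (\<forall>k. Ck k \<eta>) \<and> compact (closure {x. \<eta> x \<noteq> 0})"

definition laplacian :: "(R4 \<Rightarrow> complex) \<Rightarrow> R4 \<Rightarrow> complex"
  where "laplacian f x = (\<Sum>i\<in>Basis. partial i (partial i f) x)"

definition locally_integrable :: "(R4 \<Rightarrow> complex) \<Rightarrow> bool"
  where "locally_integrable f \<longleftrightarrow> (\<forall>K. compact K \<longrightarrow> set_integrable lebesgue K f)"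

(* H \<psi> = 0 as a distribution, for H = (-\<Delta>)^2 + V. The sign in (-\<Delta>)^2 cancels, and \<Delta>^2 is moved
   onto the test function without complex conjugation. *)
definition H_zero_distr :: "(R4 \<Rightarrow> real) \<Rightarrow> (R4 \<Rightarrow> complex) \<Rightarrow> bool"
  where "H_zero_distr V \<psi> \<longleftrightarrow>
           locally_integrable \<psi> \<and> locally_integrable (mult_op V \<psi>) \<and>
           (\<forall>\<eta>. test_function \<eta> \<longrightarrow>
              (LINT x|lebesgue. \<psi> x * laplacian (laplacian \<eta>) x)
              + (LINT x|lebesgue. mult_op V \<psi> x * \<eta> x) = 0)"

end

theory Submission
  imports Defs
begin

text \<open>
  Let \<open>\<phi>\<close> lie in the kernel of \<open>QTQ\<close>. Then \<open>\<phi>\<close> is orthogonal to \<open>v\<close> and \<open>Q T \<phi> = 0\<close>, so \<open>T \<phi> = c\<^sub>0 v\<close>,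
  and pairing with \<open>v\<close> determines \<open>c\<^sub>0\<close>. Written out, \<open>U \<phi> + v G\<^sub>1 v \<phi> = c\<^sub>0 v\<close>; multiplying by \<open>U\<close> gives
  \<open>\<phi> = U v \<psi>\<close> with \<open>\<psi> = c\<^sub>0 - G\<^sub>1 v \<phi>\<close> (\<open>ker_QTQ_characterization\<close>).

  All analytic properties of \<open>\<psi>\<close> come from one cancellation: the density \<open>F = v \<phi>\<close> has mean zero, so the
  kernel \<open>ln |x - y|\<close> of \<open>G\<^sub>1\<close> may be replaced by \<open>ln |x - y| - ln (jap x)\<close>. This difference is bounded by
  \<open>log_kernel x y\<close>, which grows only logarithmically in \<open>y\<close> and has only a logarithmic singularity at \<open>y = x\<close>,
  uniformly in \<open>x\<close> (\<open>log_kernel_bound\<close>); since its square is integrable against \<open>v\<^sup>2\<close>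
  (\<open>log_kernel_weighted_L2\<close>) and \<open>\<phi>\<close> is in \<open>L\<^sup>2\<close>, the potential is bounded. The difference is also bounded by a
  multiple of \<open>jap y / jap x\<close> times \<open>log_kernel x y\<close> (\<open>log_kernel_bound_decay\<close>). If \<open>v\<close> decays one power faster,
  the factor \<open>jap y\<close> is absorbed by \<open>v\<close>, the potential is bounded by a multiple of \<open>1 / jap x\<close>, and it therefore
  lies in \<open>L\<^sup>p\<close> for every \<open>p\<close> above the dimension 4.

  For the equation, \<open>V \<psi> = v U v \<psi> = v \<phi> = F\<close>, so it has to be shown that \<open>\<Delta>\<^sup>2 G\<^sub>1 F = F\<close> in the sense of
  distributions. By symmetry of the kernel (\<open>G1_symmetric\<close>) this reduces to \<open>G\<^sub>1 \<Delta>\<^sup>2 \<eta> = \<eta>\<close> for test functions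
  (\<open>G1_bilaplacian\<close>). The logarithm is replaced by the smooth function \<open>ln (|x - y|\<^sup>2 + d) / 2\<close>, whose bilaplacian
  is \<open>- 48 d\<^sup>2 / (|x - y|\<^sup>2 + d) ^ 4\<close>; this has total mass \<open>- 8 \<pi>\<^sup>2\<close> and concentrates at \<open>y\<close> as \<open>d\<close> tends
  to 0. Integrating by parts before passing to the limit avoids surface integrals.
\<close>

section \<open>Radial integrals\<close>

text \<open>A radial integral is reduced to one over the half-line by writing the profile as the tail integral
  of a density and exchanging the order of integration: the points to which the density at
  \<open>r\<close> contributes fill the ball of radius \<open>r\<close>, whose volume is known. All
  integrals of radial functions below are computed or bounded this way.\<close>
lemma nn_integral_layer_cake:
  fixes k :: "real \<Rightarrow> ennreal"
  assumes [measurable]: "k \<in> borel_measurable borel"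
  shows "(\<integral>\<^sup>+(x::'a::euclidean_space). (\<integral>\<^sup>+r. k r * indicator {norm x..} r \<partial>lborel) \<partial>lborel)
       = (\<integral>\<^sup>+r. k r * ennreal (unit_ball_vol (DIM('a)) * r ^ DIM('a)) * indicator {0..} r \<partial>lborel)"
proof -
  have ind: "indicator {norm x..} r = (indicator (cball 0 r) x :: ennreal)" for x :: 'a and r
    by (auto simp: indicator_def)
  have [measurable]: "Measurable.pred (borel \<Otimes>\<^sub>M borel) (\<lambda>z::real\<times>'a. norm (snd z) \<le> fst z)"
    by measurable
  have [measurable]: "(\<lambda>z::real\<times>'a. k (fst z) * indicator (cball 0 (fst z)) (snd z)) \<in> borel_measurable (borel \<Otimes>\<^sub>M borel)"
    unfolding indicator_def mem_cball_0 by measurable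
  have "(\<integral>\<^sup>+(x::'a). (\<integral>\<^sup>+r. k r * indicator {norm x..} r \<partial>lborel) \<partial>lborel)
      = (\<integral>\<^sup>+r. (\<integral>\<^sup>+(x::'a). k r * indicator (cball 0 r) x \<partial>lborel) \<partial>lborel)"
    unfolding ind by (rule lborel_pair.Fubini') (simp add: case_prod_beta')
  also have "\<dots> = (\<integral>\<^sup>+r. k r * ennreal (unit_ball_vol (DIM('a)) * r ^ DIM('a)) * indicator {0..} r \<partial>lborel)"
  proof (rule nn_integral_cong)
    fix r :: real
    show "(\<integral>\<^sup>+(x::'a). k r * indicator (cball 0 r) x \<partial>lborel)
        = k r * ennreal (unit_ball_vol (DIM('a)) * r ^ DIM('a)) * indicator {0..} r"
    proof (cases "r \<ge> 0")
      case True
      then show ?thesis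
        by (subst nn_integral_cmult_indicator) (auto simp: emeasure_cball)
    next
      case False
      then show ?thesis
        by (subst nn_integral_cmult_indicator) auto
    qed
  qed
  finally show ?thesis .
qed

lemma unit_ball_vol_4: "unit_ball_vol (DIM(real^4)) = pi\<^sup>2 / 2"
  using unit_ball_vol_even[of 2] by (simp add: fact_numeral)

lemma jap_ge_1: "1 \<le> jap x"
  by (simp add: jap_def)

lemma norm_le_jap: "norm x \<le> jap x"
  unfolding jap_def by (rule real_le_rsqrt) simp

lemma jap_measurable [measurable]: "jap \<in> borel_measurable borel"
  unfolding jap_def[abs_def] by measurable

text \<open>The exponent 4 is the dimension. The comparison function \<open>(max 1 |x|) powr -a\<close> is the
  tail integral of a power, so the layer-cake formula leaves the integral of \<open>r powr (3 -
  a)\<close> over \<open>r \<ge> 1\<close>.\<close>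
lemma nn_integral_jap_powr_finite:
  assumes a: "a > 4"
  shows "(\<integral>\<^sup>+x. ennreal (jap x powr - a) \<partial>lborel) < \<infinity>"
proof -
  define k :: "real \<Rightarrow> ennreal" where "k r = ennreal (a * r powr (- a - 1)) * indicator {1..} r" for r
  have [measurable]: "k \<in> borel_measurable borel"
    unfolding k_def[abs_def] by measurable
  obtain b :: real where b: "0 \<le> b" "b * (a - 4) = pi\<^sup>2 / 2 * a"
  proof
    show "0 \<le> pi\<^sup>2 / 2 * a / (a - 4)" using a by simp
    show "pi\<^sup>2 / 2 * a / (a - 4) * (a - 4) = pi\<^sup>2 / 2 * a"
      using a by (intro nonzero_eq_divide_eq[THEN iffD1, OF _ refl]) simp
  qed
  have tail: "(\<integral>\<^sup>+r. ennreal (b * r powr (- b - 1)) * indicator {m..} r \<partial>lborel) = ennreal (m powr - b)"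
    if "m \<ge> 1" "b > 0" for m b :: real
  proof -
    have "(\<integral>\<^sup>+r. ennreal (b * r powr (- b - 1)) * indicator {m..} r \<partial>lborel) = ennreal (0 - (- (m powr - b)))"
    proof (rule nn_integral_FTC_atLeast)
      show "((\<lambda>r. - (r powr - b)) has_field_derivative b * x powr (- b - 1)) (at x)" if "m \<le> x" for x
        using that \<open>m \<ge> 1\<close> by (auto intro!: derivative_eq_intros)
      show "((\<lambda>r. - (r powr - b)) \<longlongrightarrow> 0) at_top"
        using tendsto_minus[OF tendsto_neg_powr[OF _ filterlim_ident], of "-b"] \<open>b > 0\<close> by simp
    qed (use that in auto)
    then show ?thesis by simp
  qed
  have "(\<integral>\<^sup>+x. ennreal (jap x powr - a) \<partial>lborel) \<le> (\<integral>\<^sup>+(x::R4). (\<integral>\<^sup>+r. k r * indicator {norm x..} r \<partial>lborel) \<partial>lborel)"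
  proof (rule nn_integral_mono)
    fix x :: R4
    have "(\<integral>\<^sup>+r. k r * indicator {norm x..} r \<partial>lborel) = (\<integral>\<^sup>+r. ennreal (a * r powr (- a - 1)) * indicator {max 1 (norm x)..} r \<partial>lborel)"
      by (rule nn_integral_cong) (auto simp: k_def indicator_def)
    also have "\<dots> = ennreal (max 1 (norm x) powr - a)"
      using a by (intro tail) auto
    also have "\<dots> \<ge> ennreal (jap x powr - a)"
      using a by (intro ennreal_leI powr_mono2') (auto simp: jap_ge_1 norm_le_jap)
    finally show "ennreal (jap x powr - a) \<le> (\<integral>\<^sup>+r. k r * indicator {norm x..} r \<partial>lborel)" .
  qed
  also have "\<dots> = (\<integral>\<^sup>+r. k r * ennreal (unit_ball_vol (DIM(real^4)) * r ^ DIM(real^4)) * indicator {0..} r \<partial>lborel)"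
    by (rule nn_integral_layer_cake) measurable
  also have "\<dots> = (\<integral>\<^sup>+r. ennreal b * (ennreal ((a - 4) * r powr (- (a - 4) - 1)) * indicator {1..} r) \<partial>lborel)"
  proof (rule nn_integral_cong)
    fix r :: real
    show "k r * ennreal (unit_ball_vol (DIM(real^4)) * r ^ DIM(real^4)) * indicator {0..} r
        = ennreal b * (ennreal ((a - 4) * r powr (- (a - 4) - 1)) * indicator {1..} r)"
    proof (cases "r \<ge> 1")
      case True
      define p where "p = r powr (- a - 1)"
      define q where "q = r powr (- (a - 4) - 1)"
      have "- (a - 4) - 1 = (- a - 1) + 4" by simp
      then have "q = p * r powr 4"
        unfolding p_def q_def by (simp only: powr_add)
      then have q: "q = p * r ^ 4" using True by simp
      have "a * p * (pi\<^sup>2 / 2 * r ^ 4) = (pi\<^sup>2 / 2 * a) * q"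
        unfolding q by simp
      also have "\<dots> = b * ((a - 4) * q)"
        unfolding b(2)[symmetric] by simp
      finally have "ennreal (a * p) * ennreal (pi\<^sup>2 / 2 * r ^ 4) = ennreal b * ennreal ((a - 4) * q)"
        using a b(1) by (simp add: p_def flip: ennreal_mult')
      then show ?thesis
        using True unfolding unit_ball_vol_4 k_def p_def[symmetric] q_def[symmetric] by simp
    qed (auto simp: k_def)
  qed
  also have "\<dots> = ennreal b * ennreal (1 powr - (a - 4))"
    by (subst nn_integral_cmult; (subst tail)?) (use a in auto)
  also have "\<dots> < \<infinity>"
    by (simp add: ennreal_mult_less_top)
  finally show ?thesis .
qed

text \<open>The density of \<open>(ln r)\<^sup>2\<close> on the unit interval is \<open>- 2 ln r / r\<close>,
  and the volume factor \<open>r ^ 4\<close> more than absorbs it.\<close>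
lemma nn_integral_log_singularity_finite:
  "(\<integral>\<^sup>+(x::R4). ennreal ((max 0 (- ln (norm x)))\<^sup>2) \<partial>lborel) < \<infinity>"
proof -
  define k :: "real \<Rightarrow> ennreal" where "k r = ennreal (- 2 * ln r / r) * indicator {0<..1} r" for r
  have [measurable]: "k \<in> borel_measurable borel"
    unfolding k_def[abs_def] by measurable
  have "(\<integral>\<^sup>+(x::R4). ennreal ((max 0 (- ln (norm x)))\<^sup>2) \<partial>lborel) \<le> (\<integral>\<^sup>+(x::R4). (\<integral>\<^sup>+r. k r * indicator {norm x..} r \<partial>lborel) \<partial>lborel)"
  proof (rule nn_integral_mono)
    fix x :: R4
    show "ennreal ((max 0 (- ln (norm x)))\<^sup>2) \<le> (\<integral>\<^sup>+r. k r * indicator {norm x..} r \<partial>lborel)"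
    proof (cases "0 < norm x \<and> norm x \<le> 1")
      case True
      have pos: "0 < r" if "norm x \<le> r" for r
        using True that by linarith
      have "(\<integral>\<^sup>+r. k r * indicator {norm x..} r \<partial>lborel) = (\<integral>\<^sup>+r. ennreal (- 2 * ln r / r) * indicator {norm x..1} r \<partial>lborel)"
        using True by (intro nn_integral_cong) (auto simp: k_def indicator_def dest: pos)
      also have "\<dots> = ennreal (- (ln 1)\<^sup>2 - (- (ln (norm x))\<^sup>2))"
      proof (rule nn_integral_FTC_Icc)
        fix r assume r: "r \<in> {norm x..1}"
        then have "0 < r" by (auto intro: pos)
        then show "((\<lambda>r. - (ln r)\<^sup>2) has_field_derivative - 2 * ln r / r) (at r)"
          by (auto intro!: derivative_eq_intros)
        have "ln r \<le> 0" using r \<open>0 < r\<close> by auto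
        then show "0 \<le> - 2 * ln r / r"
          using \<open>0 < r\<close> by (simp add: divide_nonpos_pos)
      qed (use True in auto)
      also have "\<dots> = ennreal ((max 0 (- ln (norm x)))\<^sup>2)"
        using True by (auto simp: max_def)
      finally show ?thesis by simp
    next
      case False
      then have "max 0 (- ln (norm x)) = 0" by (cases "x = 0") auto
      then show ?thesis by simp
    qed
  qed
  also have "\<dots> = (\<integral>\<^sup>+r. k r * ennreal (unit_ball_vol (DIM(real^4)) * r ^ DIM(real^4)) * indicator {0..} r \<partial>lborel)"
    by (rule nn_integral_layer_cake) measurable
  also have "\<dots> \<le> (\<integral>\<^sup>+r. ennreal (pi\<^sup>2) * indicator {0..1::real} r \<partial>lborel)"
  proof (rule nn_integral_mono)
    fix r :: real
    show "k r * ennreal (unit_ball_vol (DIM(real^4)) * r ^ DIM(real^4)) * indicator {0..} r \<le> ennreal (pi\<^sup>2) * indicator {0..1} r"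
    proof (cases "0 < r \<and> r \<le> 1")
      case True
      have "- ln r = ln (1 / r)" using True by (simp add: ln_div)
      also have "\<dots> \<le> 1 / r" using True by (intro ln_bound) auto
      finally have l: "- ln r * r \<le> 1" using True by (simp add: field_simps)
      have "(- 2 * ln r / r) * (pi\<^sup>2 / 2 * r ^ 4) = pi\<^sup>2 * r\<^sup>2 * (- ln r * r)"
        using True by (simp add: field_simps power2_eq_square eval_nat_numeral)
      also have "\<dots> \<le> pi\<^sup>2 * 1 * 1"
        using True l by (intro mult_mono) (auto simp: power_le_one mult_nonpos_nonneg)
      finally have "(- 2 * ln r / r) * (pi\<^sup>2 / 2 * r ^ 4) \<le> pi\<^sup>2" by simp
      moreover have "0 \<le> - 2 * ln r / r" using True by (auto simp: divide_nonpos_pos)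
      ultimately show ?thesis
        using True unfolding unit_ball_vol_4
        by (auto simp: k_def indicator_def simp flip: ennreal_mult'')
    qed (auto simp: k_def)
  qed
  also have "\<dots> < \<infinity>"
    by (subst nn_integral_cmult_indicator) (auto simp: ennreal_mult_less_top)
  finally show ?thesis .
qed

text \<open>This is the constant that normalizes the fundamental solution: up to the factor -48 the profile is
  the bilaplacian of the regularized logarithm at unit scale, and \<open>48 * (pi\<^sup>2 / 6) = 8 *
  pi\<^sup>2\<close> cancels the prefactor of \<^const>\<open>G1\<close>.\<close>
lemma nn_integral_biharmonic_profile:
  "(\<integral>\<^sup>+(x::R4). ennreal (1 / (1 + (norm x)\<^sup>2) ^ 4) \<partial>lborel) = ennreal (pi\<^sup>2 / 6)"
proof -
  define u where "u r = 1 / (1 + r\<^sup>2)" for r :: real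
  \<comment> \<open>In the variable \<open>u\<close> the layer-cake integrand \<open>r ^ 5 / (1 + r\<^sup>2) ^ 5\<close> becomes polynomial
    against \<open>du\<close>; this is its primitive.\<close>
  define F where "F r = pi\<^sup>2 / 6 * ((1 - u r) ^ 3 * (1 + 3 * u r))" for r :: real
  have [measurable]: "u \<in> borel_measurable borel"
    unfolding u_def[abs_def] by measurable
  have pos: "1 + r\<^sup>2 > 0" for r :: real
    by (simp add: add_pos_nonneg)
  have u_nonneg: "0 \<le> u r" for r
    by (simp add: u_def)
  have u': "(u has_field_derivative (- 2 * r * (u r)\<^sup>2)) (at r)" for r
    unfolding u_def[abs_def] using pos[of r]
    by (auto intro!: derivative_eq_intros simp: power2_eq_square)
  have lim: "(u \<longlongrightarrow> 0) at_top"
  proof -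
    have "filterlim (\<lambda>x::real. 1 + x\<^sup>2) at_top at_top"
      by (intro filterlim_tendsto_add_at_top[OF tendsto_const] filterlim_pow_at_top filterlim_ident) auto
    from tendsto_inverse_0_at_top[OF this] show ?thesis
      by (simp add: u_def[abs_def] inverse_eq_divide)
  qed
  have alg: "r ^ 4 * (u r) ^ 2 = (1 - u r)\<^sup>2" for r
  proof -
    have "1 - u r = r\<^sup>2 * u r" unfolding u_def using pos[of r] by (simp add: divide_simps)
    then show ?thesis by (simp add: power_mult_distrib flip: power_mult)
  qed
  have "(\<integral>\<^sup>+(x::R4). ennreal (1 / (1 + (norm x)\<^sup>2) ^ 4) \<partial>lborel) = (\<integral>\<^sup>+(x::R4). (\<integral>\<^sup>+r. ennreal (8 * r * u r ^ 5) * indicator {norm x..} r \<partial>lborel) \<partial>lborel)"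
  proof (rule nn_integral_cong)
    fix x :: R4
    have "(\<integral>\<^sup>+r. ennreal (8 * r * u r ^ 5) * indicator {norm x..} r \<partial>lborel) = ennreal (0 - (- (u (norm x) ^ 4)))"
    proof (rule nn_integral_FTC_atLeast)
      fix r :: real
      have "((\<lambda>r. - (u r ^ 4)) has_field_derivative - (4 * u r ^ 3 * (- 2 * r * (u r)\<^sup>2))) (at r)"
        by (rule derivative_eq_intros u' refl)+ simp
      also have "- (4 * u r ^ 3 * (- 2 * r * (u r)\<^sup>2)) = 8 * r * u r ^ 5"
        by (simp add: power2_eq_square eval_nat_numeral)
      finally show "((\<lambda>r. - (u r ^ 4)) has_field_derivative 8 * r * u r ^ 5) (at r)" .
      show "0 \<le> 8 * r * u r ^ 5" if "norm x \<le> r"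
        using order_trans[OF norm_ge_zero that] u_nonneg[of r] by simp
      show "((\<lambda>r. - (u r ^ 4)) \<longlongrightarrow> 0) at_top"
        using tendsto_minus[OF tendsto_power[OF lim, of 4]] by simp
    qed measurable
    then show "ennreal (1 / (1 + (norm x)\<^sup>2) ^ 4) = (\<integral>\<^sup>+r. ennreal (8 * r * u r ^ 5) * indicator {norm x..} r \<partial>lborel)"
      by (simp add: u_def power_divide)
  qed
  also have "\<dots> = (\<integral>\<^sup>+r. ennreal (8 * r * u r ^ 5) * ennreal (unit_ball_vol (DIM(real^4)) * r ^ DIM(real^4)) * indicator {0..} r \<partial>lborel)"
    by (rule nn_integral_layer_cake) measurable
  also have "\<dots> = (\<integral>\<^sup>+r. ennreal (4 * pi\<^sup>2 * (r * u r ^ 3 * (1 - u r)\<^sup>2)) * indicator {0..} r \<partial>lborel)"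
  proof (rule nn_integral_cong)
    fix r :: real
    have "8 * r * u r ^ 5 * (pi\<^sup>2 / 2 * r ^ 4) = 4 * pi\<^sup>2 * (r * u r ^ 3 * (r ^ 4 * (u r) ^ 2))"
      by (simp add: eval_nat_numeral)
    then show "ennreal (8 * r * u r ^ 5) * ennreal (unit_ball_vol (DIM(real^4)) * r ^ DIM(real^4)) * indicator {0..} r
       = ennreal (4 * pi\<^sup>2 * (r * u r ^ 3 * (1 - u r)\<^sup>2)) * indicator {0..} r"
      using u_nonneg[of r]
      unfolding unit_ball_vol_4 alg by (auto simp: indicator_def simp flip: ennreal_mult')
  qed
  also have "\<dots> = ennreal (pi\<^sup>2 / 6 - F 0)"
  proof (rule nn_integral_FTC_atLeast)
    fix r :: real
    have "(F has_field_derivative pi\<^sup>2 / 6 * (3 * (1 - u r)\<^sup>2 * (2 * r * (u r)\<^sup>2) * (1 + 3 * u r) + (1 - u r) ^ 3 * (3 * (- 2 * r * (u r)\<^sup>2)))) (at r)"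
      unfolding F_def[abs_def]
      by (rule derivative_eq_intros u' refl)+ simp
    also have "pi\<^sup>2 / 6 * (3 * (1 - u r)\<^sup>2 * (2 * r * (u r)\<^sup>2) * (1 + 3 * u r) + (1 - u r) ^ 3 * (3 * (- 2 * r * (u r)\<^sup>2)))
        = 4 * pi\<^sup>2 * (r * u r ^ 3 * (1 - u r)\<^sup>2)"
      by algebra
    finally show "(F has_field_derivative 4 * pi\<^sup>2 * (r * u r ^ 3 * (1 - u r)\<^sup>2)) (at r)" .
    show "0 \<le> 4 * pi\<^sup>2 * (r * u r ^ 3 * (1 - u r)\<^sup>2)" if "0 \<le> r"
      using that u_nonneg[of r] by simp
  next
    have "(F \<longlongrightarrow> pi\<^sup>2 / 6 * ((1 - 0) ^ 3 * (1 + 3 * 0))) at_top"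
      unfolding F_def by (intro tendsto_intros lim)
    then show "(F \<longlongrightarrow> pi\<^sup>2 / 6) at_top" by simp
  qed measurable
  finally show ?thesis by (simp add: F_def u_def)
qed

section \<open>The logarithmic kernel\<close>

text \<open>A majorant of the difference between \<open>ln |x - y|\<close> and \<open>ln (jap x)\<close>: the
  first logarithm accounts for large \<open>y\<close>, the truncated one for the singularity at
  \<open>y = x\<close>. The summand 1 makes it at least 1, so that integrals against it control
  integrals without it.\<close>
definition log_kernel :: "R4 \<Rightarrow> R4 \<Rightarrow> real"
  where "log_kernel x y = 1 + ln (2 + norm y) + max 0 (- ln (norm (x - y)))"

lemma log_kernel_ge_1: "1 \<le> log_kernel x y"
proof -
  have "0 \<le> ln (2 + norm y)" by (rule ln_ge_zero) simp
  then show ?thesis by (simp add: log_kernel_def)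
qed

lemma log_kernel_measurable [measurable]:
  "log_kernel x \<in> borel_measurable borel"
  unfolding log_kernel_def[abs_def] by measurable

lemma jap_le: "jap x \<le> 1 + norm x"
  unfolding jap_def by (rule real_le_lsqrt) (auto simp: power2_eq_square algebra_simps)

lemma jap_pos: "0 < jap x"
  using jap_ge_1[of x] by linarith

text \<open>Subtracting \<open>ln (jap x)\<close> removes the growth of the logarithm in \<open>x\<close>,
  uniformly in \<open>x\<close>, since \<open>|x - y|\<close> and \<open>jap x\<close> differ at
  most by the factor \<open>2 + |y|\<close> away from the singularity. This is what makes potentials
  of mean-zero densities bounded.\<close>
lemma log_kernel_bound: "\<bar>ln (norm (x - y)) - ln (jap x)\<bar> \<le> log_kernel x y"
proof -
  let ?r = "norm (x - y)"
  have l2: "0 \<le> ln (2 + norm y)" by (rule ln_ge_zero) simp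
  have x1: "norm x \<le> ?r + norm y"
    using norm_triangle_sub[of x y] by (simp add: add.commute)
  have r1: "?r \<le> norm x + norm y" by (rule norm_triangle_ineq4)
  have upper: "ln ?r \<le> ln (jap x) + ln (2 + norm y)"
  proof (cases "?r = 0")
    case True
    then show ?thesis using l2 ln_ge_zero[OF jap_ge_1[of x]] by simp
  next
    case False
    have "?r \<le> jap x * 1 + jap x * norm y"
      using r1 norm_le_jap[of x] mult_right_mono[OF jap_ge_1[of x], of "norm y"] by simp
    also have "\<dots> \<le> jap x * (2 + norm y)"
      using jap_pos[of x] by (simp add: algebra_simps)
    finally have "ln ?r \<le> ln (jap x * (2 + norm y))"
      using False by (intro ln_mono) auto
    also have "\<dots> = ln (jap x) + ln (2 + norm y)"
      using jap_pos[of x] by (intro ln_mult_pos) (auto intro: add_pos_nonneg)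
    finally show ?thesis .
  qed
  have lower: "ln (jap x) \<le> ln (2 + norm y) + max 0 (- ln ?r) + ln ?r"
  proof (cases "?r \<ge> 1")
    case True
    have "jap x \<le> 1 + (?r + norm y)" using jap_le[of x] x1 by simp
    also have "\<dots> \<le> ?r * (2 + norm y)"
      using True mult_right_mono[OF True, of "norm y"] by (simp add: algebra_simps)
    finally have "ln (jap x) \<le> ln (?r * (2 + norm y))"
      using jap_pos[of x] by (intro ln_mono) auto
    also have "\<dots> = ln ?r + ln (2 + norm y)"
      using True by (intro ln_mult_pos) (auto intro: add_pos_nonneg)
    finally show ?thesis by simp
  next
    case False
    have "jap x \<le> 2 + norm y" using jap_le[of x] x1 False by simp
    then have "ln (jap x) \<le> ln (2 + norm y)"
      using jap_pos[of x] by (intro ln_mono) auto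
    then show ?thesis by (simp add: max_def)
  qed
  show ?thesis
    using upper lower unfolding log_kernel_def by (simp add: abs_le_iff max_def split: if_splits)
qed

lemma ln_diff_le:
  fixes a b m :: real
  assumes "m \<le> a" "m \<le> b" "0 < m"
  shows "\<bar>ln a - ln b\<bar> \<le> \<bar>a - b\<bar> / m"
proof -
  have *: "ln a - ln b \<le> \<bar>a - b\<bar> / m" if "m \<le> a" "m \<le> b" for a b :: real
  proof -
    have "ln a - ln b = ln (a / b)" using that assms(3) by (simp add: ln_div)
    also have "\<dots> \<le> a / b - 1" using that assms(3) by (intro ln_le_minus_one) auto
    also have "\<dots> = (a - b) / b" using that assms(3) by (simp add: diff_divide_distrib)
    also have "\<dots> \<le> \<bar>a - b\<bar> / m"
      using that assms(3) by (intro frac_le) auto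
    finally show ?thesis .
  qed
  show ?thesis using *[of a b] *[of b a] assms by (auto simp: abs_le_iff abs_minus_commute)
qed

text \<open>One factor \<open>jap y\<close> buys one power of decay in \<open>x\<close>. If \<open>y\<close> is
  not small compared with \<open>x\<close>, then \<open>jap y / jap x\<close> is bounded below and
  the bound without decay suffices; otherwise both arguments of the logarithm are comparable to
  \<open>jap x\<close> and differ by at most a multiple of \<open>jap y\<close>, so that the mean
  value bound applies.\<close>
lemma log_kernel_bound_decay:
  "\<bar>ln (norm (x - y)) - ln (jap x)\<bar> \<le> 8 * (jap y / jap x) * log_kernel x y"
proof (cases "norm y < norm x / 2 \<and> norm x \<ge> 1")
  case False
  have "jap x \<le> 2 * jap y"
    using False jap_le[of x] jap_ge_1[of y] norm_le_jap[of y]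
  proof (cases "norm x \<ge> 1")
    case True
    have "(jap x)\<^sup>2 \<le> (2 * jap y)\<^sup>2"
    proof -
      have "(norm x)\<^sup>2 \<le> (2 * norm y)\<^sup>2" using False True by (intro power_mono) auto
      then show ?thesis by (simp add: jap_def power_mult_distrib)
    qed
    then show ?thesis by (rule power2_le_imp_le) (use jap_pos[of y] in auto)
  qed auto
  then have "1 \<le> 8 * (jap y / jap x)"
    using jap_pos[of x] jap_pos[of y] by (simp add: field_simps)
  then have "log_kernel x y \<le> 8 * (jap y / jap x) * log_kernel x y"
    using log_kernel_ge_1[of x y] mult_right_mono[of 1 "8 * (jap y / jap x)" "log_kernel x y"] by simp
  then show ?thesis using log_kernel_bound[of x y] by linarith
next
  case True
  let ?r = "norm (x - y)"
  have r1: "?r \<le> norm x + norm y" by (rule norm_triangle_ineq4)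
  have r2: "norm x \<le> ?r + norm y"
    using norm_triangle_sub[of x y] by (simp add: add.commute)
  have jx: "norm x \<le> jap x" "jap x \<le> 1 + norm x" using norm_le_jap jap_le by auto
  have "\<bar>ln ?r - ln (jap x)\<bar> \<le> \<bar>?r - jap x\<bar> / (jap x / 4)"
    using True r2 jx by (intro ln_diff_le) auto
  also have "\<dots> \<le> (2 * jap y) / (jap x / 4)"
    using r1 r2 jx jap_ge_1[of y] norm_le_jap[of y] jap_pos[of x] by (intro divide_right_mono) auto
  also have "\<dots> = 8 * (jap y / jap x) * 1" by simp
  also have "\<dots> \<le> 8 * (jap y / jap x) * log_kernel x y"
    using log_kernel_ge_1[of x y] jap_pos[of x] jap_pos[of y] by (intro mult_left_mono) auto
  finally show ?thesis .
qed

lemma ln_2_le_jap_powr: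
  assumes "0 < e"
  shows "1 + ln (2 + norm y) \<le> (1 + 1 / e) * jap y powr e * 3 powr e"
proof -
  have "1 + ln (2 + norm y) \<le> 1 + (2 + norm y) powr e / e"
    using ln_powr_bound[of "2 + norm y" e] assms by simp
  also have "\<dots> \<le> 1 + (3 * jap y) powr e / e"
    using norm_le_jap[of y] jap_ge_1[of y] assms
    by (intro add_left_mono divide_right_mono powr_mono2) auto
  also have "\<dots> \<le> (3 * jap y) powr e + (3 * jap y) powr e / e"
    using jap_ge_1[of y] assms by (intro add_right_mono ge_one_powr_ge_zero) auto
  also have "\<dots> = (1 + 1 / e) * jap y powr e * 3 powr e"
    using jap_pos[of y] by (simp add: powr_mult algebra_simps)
  finally show ?thesis .
qed

lemma nn_integral_lborel_reflect_translate:
  fixes f :: "'a::euclidean_space \<Rightarrow> ennreal"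
  assumes [measurable]: "f \<in> borel_measurable borel"
  shows "(\<integral>\<^sup>+y. f (x - y) \<partial>lborel) = (\<integral>\<^sup>+y. f y \<partial>lborel)"
proof -
  have "(\<integral>\<^sup>+y. f y \<partial>lborel) = (\<integral>\<^sup>+y. f y \<partial>density (distr lborel borel (\<lambda>y. x + (-1) *\<^sub>R y)) (\<lambda>_. \<bar>-1::real\<bar> ^ DIM('a)))"
    by (subst lborel_affine[of "-1" x, symmetric]) auto
  also have "\<dots> = (\<integral>\<^sup>+y. f (x - y) \<partial>lborel)"
    by (subst nn_integral_density) (auto simp: nn_integral_distr)
  finally show ?thesis ..
qed

text \<open>The decay exponent 2 is exactly half the dimension: \<open>w\<^sup>2\<close> decays faster than
  \<open>jap y powr -4\<close>, with room for the logarithm of \<open>y\<close>, and near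
  \<open>x\<close> the weight is bounded while the squared logarithm is integrable, uniformly in
  \<open>x\<close> by translation.\<close>
lemma log_kernel_weighted_L2:
  assumes "decays 2 w"
  shows "\<exists>M::real. \<forall>x. (\<integral>\<^sup>+y. ennreal ((log_kernel x y * w y)\<^sup>2) \<partial>lborel) \<le> ennreal M"
proof -
  obtain C e where C: "C > 0" and e: "e > 0" and w: "AE y in lborel. \<bar>w y\<bar> \<le> C * jap y powr (- 2 - e)"
    using assms unfolding decays_def AE_completion_iff by blast
  \<comment> \<open>The logarithm of \<open>y\<close> is paid for by half of the surplus decay.\<close>
  define d where "d = e / 2"
  have d: "d > 0" using e by (simp add: d_def)
  define D where "D = (1 + 1 / d) * 3 powr d"
  define A where "A = (\<integral>\<^sup>+y. ennreal (jap y powr - (4 + e)) \<partial>lborel)"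
  define B where "B = (\<integral>\<^sup>+(y::R4). ennreal ((max 0 (- ln (norm y)))\<^sup>2) \<partial>lborel)"
  define M where "M = ennreal (2 * C\<^sup>2 * D\<^sup>2) * A + ennreal (2 * C\<^sup>2) * B"
  have "A < \<infinity>" unfolding A_def using nn_integral_jap_powr_finite[of "4 + e"] e by simp
  moreover have "B < \<infinity>" unfolding B_def by (rule nn_integral_log_singularity_finite)
  ultimately have M: "M < \<infinity>" by (simp add: M_def ennreal_mult_less_top)
  have le: "(\<integral>\<^sup>+y. ennreal ((log_kernel x y * w y)\<^sup>2) \<partial>lborel) \<le> M" for x
  proof -
    have "(\<integral>\<^sup>+y. ennreal ((log_kernel x y * w y)\<^sup>2) \<partial>lborel)
       \<le> (\<integral>\<^sup>+y. ennreal (2 * C\<^sup>2 * D\<^sup>2) * ennreal (jap y powr - (4 + e)) + ennreal (2 * C\<^sup>2) * ennreal ((max 0 (- ln (norm (x - y))))\<^sup>2) \<partial>lborel)"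
    proof (rule nn_integral_mono_AE, use w in eventually_elim)
      case (elim y)
      define a where "a = 1 + ln (2 + norm y)"
      define b where "b = max 0 (- ln (norm (x - y)))"
      define j where "j = jap y"
      have j: "j \<ge> 1" by (simp add: j_def jap_ge_1)
      have a0: "0 \<le> a" using ln_ge_zero[of "2 + norm y"] by (simp add: a_def)
      have a1: "a \<le> D * j powr d"
        using ln_2_le_jap_powr[OF d, of y] by (simp add: a_def D_def j_def mult_ac)
      have w1: "\<bar>w y\<bar> \<le> C * j powr (- 2 - e)" using elim by (simp add: j_def)
      have w2: "\<bar>w y\<bar> \<le> C"
      proof -
        have "j powr (- 2 - e) \<le> j powr 0" using j e by (intro powr_mono) auto
        then have "C * j powr (- 2 - e) \<le> C * 1" using C j by (intro mult_left_mono) auto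
        then show ?thesis using w1 by simp
      qed
      have "(a * w y)\<^sup>2 \<le> (D * j powr d * (C * j powr (- 2 - e)))\<^sup>2"
      proof -
        have "\<bar>a * w y\<bar> \<le> D * j powr d * (C * j powr (- 2 - e))"
          unfolding abs_mult using a0 a1 w1 by (intro mult_mono) auto
        then show ?thesis by (metis abs_ge_zero power2_abs power_mono)
      qed
      also have "\<dots> = C\<^sup>2 * D\<^sup>2 * (j powr d * j powr (- 2 - e))\<^sup>2"
        by (simp add: power_mult_distrib)
      also have "(j powr d * j powr (- 2 - e))\<^sup>2 = j powr - (4 + e)"
      proof -
        have "d + (- 2 - e) + (d + (- 2 - e)) = - (4 + e)" by (simp add: d_def)
        then show ?thesis by (simp only: power2_eq_square powr_add[symmetric])
      qed
      finally have t1: "(a * w y)\<^sup>2 \<le> C\<^sup>2 * D\<^sup>2 * j powr - (4 + e)" .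
      have t2: "(b * w y)\<^sup>2 \<le> C\<^sup>2 * b\<^sup>2"
      proof -
        have "\<bar>w y\<bar>\<^sup>2 \<le> C\<^sup>2" using w2 by (intro power_mono) auto
        then show ?thesis by (simp add: power_mult_distrib mult.commute[of "b\<^sup>2"] mult_right_mono)
      qed
      have "(log_kernel x y * w y)\<^sup>2 = (a * w y + b * w y)\<^sup>2"
        by (simp add: log_kernel_def a_def b_def algebra_simps)
      also have "\<dots> \<le> 2 * (a * w y)\<^sup>2 + 2 * (b * w y)\<^sup>2"
        using sum_squares_bound[of "a * w y" "b * w y"] by (simp add: power2_sum)
      also have "\<dots> \<le> 2 * C\<^sup>2 * D\<^sup>2 * j powr - (4 + e) + 2 * C\<^sup>2 * b\<^sup>2"
        using t1 t2 by simp
      finally have "ennreal ((log_kernel x y * w y)\<^sup>2) \<le> ennreal (2 * C\<^sup>2 * D\<^sup>2 * j powr - (4 + e) + 2 * C\<^sup>2 * b\<^sup>2)"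
        by (rule ennreal_leI)
      then show ?case
        unfolding j_def[symmetric] b_def[symmetric]
        by (simp add: ennreal_plus ennreal_mult)
    qed
    also have "\<dots> = ennreal (2 * C\<^sup>2 * D\<^sup>2) * A + ennreal (2 * C\<^sup>2) * (\<integral>\<^sup>+y. ennreal ((max 0 (- ln (norm (x - y))))\<^sup>2) \<partial>lborel)"
      unfolding A_def by (subst nn_integral_add) (auto simp: nn_integral_cmult)
    also have "(\<integral>\<^sup>+y. ennreal ((max 0 (- ln (norm (x - y))))\<^sup>2) \<partial>lborel) = B"
      unfolding B_def
      by (rule nn_integral_lborel_reflect_translate[where f = "\<lambda>y. ennreal ((max 0 (- ln (norm y)))\<^sup>2)"]) measurable
    finally show ?thesis by (simp add: M_def)
  qed
  obtain m where "M = ennreal m" using M by (cases M) auto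
  then show ?thesis using le by auto
qed

section \<open>Logarithmic potentials\<close>

text \<open>The class of densities whose potentials are treated: a single bound for the integrals against the
  kernels centred at all points gives at once integrability, convergence of the logarithmic
  potential everywhere, and its growth or boundedness.\<close>
definition log_bounded :: "(R4 \<Rightarrow> complex) \<Rightarrow> real \<Rightarrow> bool"
  where "log_bounded F M \<longleftrightarrow> F \<in> borel_measurable lebesgue \<and> 0 \<le> M \<and>
           (\<forall>x. (\<integral>\<^sup>+y. ennreal (log_kernel x y * norm (F y)) \<partial>lborel) \<le> ennreal M)"

lemma log_bounded_AE:
  assumes "log_bounded F M" "F' \<in> borel_measurable lebesgue" "F =ae F'"
  shows "log_bounded F' M"
proof -
  have "(\<integral>\<^sup>+y. ennreal (log_kernel x y * norm (F y)) \<partial>lborel) = (\<integral>\<^sup>+y. ennreal (log_kernel x y * norm (F' y)) \<partial>lborel)" for x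
    using assms(3) unfolding AE_completion_iff
    by (intro nn_integral_cong_AE) (auto elim: eventually_mono)
  then show ?thesis using assms by (simp add: log_bounded_def)
qed

text \<open>Fubini's theorem is applied to the product of Borel measures, whereas the densities are only
  Lebesgue measurable.\<close>
lemma lebesgue_complex_borel_representative:
  fixes f :: "'a::euclidean_space \<Rightarrow> complex"
  assumes [measurable]: "f \<in> borel_measurable lebesgue"
  obtains g where "g \<in> borel_measurable borel" "AE x in lebesgue. f x = g x"
proof -
  have "(\<lambda>x. Re (f x)) \<in> borel_measurable lebesgue" "(\<lambda>x. Im (f x)) \<in> borel_measurable lebesgue"
    by measurable
  from this[THEN completion_ex_borel_measurable_real]
  obtain a b where [measurable]: "a \<in> borel_measurable lborel" "b \<in> borel_measurable lborel"
    and *: "AE x in lborel. Re (f x) = a x" "AE x in lborel. Im (f x) = b x"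
    by blast
  show ?thesis
  proof
    have "(\<lambda>x. complex_of_real (a x) + \<i> * complex_of_real (b x)) \<in> borel_measurable lborel"
      by measurable
    then show "(\<lambda>x. complex_of_real (a x) + \<i> * complex_of_real (b x)) \<in> borel_measurable borel"
      by simp
    show "AE x in lebesgue. f x = complex_of_real (a x) + \<i> * complex_of_real (b x)"
      unfolding AE_completion_iff using * by eventually_elim (simp add: complex_eq_iff)
  qed
qed

lemma borel_imp_lebesgue_measurable:
  "f \<in> borel_measurable borel \<Longrightarrow> f \<in> borel_measurable (lebesgue :: 'a::euclidean_space measure)"
  by (rule measurable_completion) simp

lemma G1_cong_AE:
  assumes [measurable]: "F \<in> borel_measurable lebesgue" "F' \<in> borel_measurable lebesgue" and "F =ae F'"
  shows "G1 F = G1 F'"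
proof
  fix x :: R4
  have [measurable]: "(\<lambda>y. complex_of_real (ln (norm (x - y)))) \<in> borel_measurable lebesgue"
    by (rule borel_imp_lebesgue_measurable) measurable
  have "(LINT y|lebesgue. complex_of_real (ln (norm (x - y))) * F y) = (LINT y|lebesgue. complex_of_real (ln (norm (x - y))) * F' y)"
    using assms(3) by (intro integral_cong_AE) (auto elim: eventually_mono)
  then show "G1 F x = G1 F' x" by (simp add: G1_def)
qed

text \<open>Any kernel dominated by \<^const>\<open>log_kernel\<close> can be integrated against the density.
  The main cases are the logarithm itself, its difference from \<open>ln (jap x)\<close>, and that
  difference divided by \<open>jap y\<close>.\<close>
lemma log_bounded_integral:
  assumes F: "log_bounded F M" and k: "k \<in> borel_measurable borel"
    and bound: "\<And>y. \<bar>k y\<bar> \<le> A * log_kernel x y" and A: "0 \<le> A"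
  shows "integrable lebesgue (\<lambda>y. complex_of_real (k y) * F y)"
    and "norm (LINT y|lebesgue. complex_of_real (k y) * F y) \<le> A * M"
    and "(LINT y|lebesgue. norm (complex_of_real (k y) * F y)) \<le> A * M"
proof -
  have [measurable]: "F \<in> borel_measurable lebesgue" "k \<in> borel_measurable lebesgue"
    using F borel_imp_lebesgue_measurable[OF k] by (auto simp: log_bounded_def)
  have [measurable]: "log_kernel x \<in> borel_measurable lebesgue"
    by (rule borel_imp_lebesgue_measurable) measurable
  have M: "0 \<le> M" using F by (simp add: log_bounded_def)
  have "(\<integral>\<^sup>+y. ennreal (norm (complex_of_real (k y) * F y)) \<partial>lebesgue) \<le> (\<integral>\<^sup>+y. ennreal A * ennreal (log_kernel x y * norm (F y)) \<partial>lebesgue)"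
  proof (rule nn_integral_mono)
    fix y
    have "norm (complex_of_real (k y) * F y) \<le> A * log_kernel x y * norm (F y)"
      using bound[of y] by (simp add: norm_mult mult_right_mono)
    then show "ennreal (norm (complex_of_real (k y) * F y)) \<le> ennreal A * ennreal (log_kernel x y * norm (F y))"
      using A by (simp add: mult.assoc ennreal_leI flip: ennreal_mult')
  qed
  also have "\<dots> = ennreal A * (\<integral>\<^sup>+y. ennreal (log_kernel x y * norm (F y)) \<partial>lborel)"
    by (subst nn_integral_cmult) (auto simp: nn_integral_completion)
  also have "\<dots> \<le> ennreal A * ennreal M"
    using F by (intro mult_left_mono) (auto simp: log_bounded_def)
  also have "\<dots> = ennreal (A * M)" using A by (simp add: ennreal_mult')
  finally have le: "(\<integral>\<^sup>+y. ennreal (norm (complex_of_real (k y) * F y)) \<partial>lebesgue) \<le> ennreal (A * M)" .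
  show int: "integrable lebesgue (\<lambda>y. complex_of_real (k y) * F y)"
    by (rule integrableI_bounded) (use le in \<open>auto intro: le_less_trans\<close>)
  show n: "(LINT y|lebesgue. norm (complex_of_real (k y) * F y)) \<le> A * M"
    using le A M by (subst (asm) nn_integral_eq_integral) (use int in auto)
  show "norm (LINT y|lebesgue. complex_of_real (k y) * F y) \<le> A * M"
    using integral_norm_bound[of lebesgue "\<lambda>y. complex_of_real (k y) * F y"] n by linarith
qed

lemma log_bounded_integrable:
  assumes "log_bounded F M"
  shows "integrable lebesgue F"
  using log_bounded_integral(1)[OF assms, of "\<lambda>_. 1" 1 0] log_kernel_ge_1 by simp

lemma Lp_2_iff:
  "f \<in> Lp 2 \<longleftrightarrow> f \<in> borel_measurable lebesgue \<and> integrable lebesgue (\<lambda>x. (norm (f x))\<^sup>2)"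
  by (simp add: Lp_def)

text \<open>The inequality \<open>a * b \<le> a\<^sup>2 + b\<^sup>2\<close> separates the square-integrable
  factor \<open>f\<close> from the kernel and the weight; the latter two are square integrable
  together, uniformly in \<open>x\<close>.\<close>
lemma log_bounded_weight:
  assumes w: "decays 2 w" and [measurable]: "w \<in> borel_measurable lebesgue" and f: "f \<in> Lp 2"
  shows "\<exists>M. log_bounded (\<lambda>x. complex_of_real (w x) * f x) M"
proof -
  have [measurable]: "f \<in> borel_measurable lebesgue" and fi: "integrable lebesgue (\<lambda>x. (norm (f x))\<^sup>2)"
    using f by (auto simp: Lp_2_iff)
  obtain M where M: "\<And>x. (\<integral>\<^sup>+y. ennreal ((log_kernel x y * w y)\<^sup>2) \<partial>lborel) \<le> ennreal M"
    using log_kernel_weighted_L2[OF w] by blast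
  define N where "N = (LINT x|lebesgue. (norm (f x))\<^sup>2)"
  have N: "(\<integral>\<^sup>+x. ennreal ((norm (f x))\<^sup>2) \<partial>lebesgue) = ennreal N" "0 \<le> N"
    unfolding N_def using nn_integral_eq_integral[OF fi] by auto
  have "(\<integral>\<^sup>+y. ennreal (log_kernel x y * norm (complex_of_real (w y) * f y)) \<partial>lborel) \<le> ennreal (max 0 M + N)" for x
  proof -
    have [measurable]: "log_kernel x \<in> borel_measurable lebesgue"
      by (rule borel_imp_lebesgue_measurable) measurable
    have "(\<integral>\<^sup>+y. ennreal (log_kernel x y * norm (complex_of_real (w y) * f y)) \<partial>lebesgue)
      \<le> (\<integral>\<^sup>+y. ennreal ((log_kernel x y * w y)\<^sup>2) + ennreal ((norm (f y))\<^sup>2) \<partial>lebesgue)"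
    proof (rule nn_integral_mono)
      fix y
      define a where "a = \<bar>log_kernel x y * w y\<bar>"
      define b where "b = norm (f y)"
      have "0 \<le> a" "0 \<le> b" by (auto simp: a_def b_def)
      then have "a * b \<le> a\<^sup>2 + b\<^sup>2"
        using sum_squares_bound[of a b] mult_nonneg_nonneg[of a b] by linarith
      moreover have "log_kernel x y * norm (complex_of_real (w y) * f y) = a * b"
        using log_kernel_ge_1[of x y] by (simp add: a_def b_def norm_mult abs_mult)
      moreover have "a\<^sup>2 = (log_kernel x y * w y)\<^sup>2" by (simp add: a_def)
      ultimately have "ennreal (log_kernel x y * norm (complex_of_real (w y) * f y)) \<le> ennreal ((log_kernel x y * w y)\<^sup>2 + (norm (f y))\<^sup>2)"
        unfolding b_def by (intro ennreal_leI) linarith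
      then show "ennreal (log_kernel x y * norm (complex_of_real (w y) * f y)) \<le> ennreal ((log_kernel x y * w y)\<^sup>2) + ennreal ((norm (f y))\<^sup>2)"
        by simp
    qed
    also have "\<dots> = (\<integral>\<^sup>+y. ennreal ((log_kernel x y * w y)\<^sup>2) \<partial>lebesgue) + ennreal N"
      by (subst nn_integral_add) (auto simp: N)
    also have "\<dots> \<le> ennreal (max 0 M) + ennreal N"
      using order_trans[OF M ennreal_leI[of M "max 0 M"]]
      by (intro add_right_mono) (simp add: nn_integral_completion)
    also have "\<dots> = ennreal (max 0 M + N)" using N by simp
    finally show ?thesis by (simp add: nn_integral_completion)
  qed
  then have "log_bounded (\<lambda>x. complex_of_real (w x) * f x) (max 0 M + N)"
    unfolding log_bounded_def using N by auto
  then show ?thesis ..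
qed

lemma abs_log_le: "\<bar>ln (norm (x - y))\<bar> \<le> (ln (jap x) + 1) * log_kernel x y"
proof -
  have "0 \<le> ln (jap x)" by (rule ln_ge_zero[OF jap_ge_1])
  then have "ln (jap x) * 1 \<le> ln (jap x) * log_kernel x y"
    by (intro mult_left_mono log_kernel_ge_1)
  moreover have "\<bar>ln (norm (x - y))\<bar> \<le> log_kernel x y + ln (jap x)"
    using log_kernel_bound[of x y] \<open>0 \<le> ln (jap x)\<close> by linarith
  ultimately show ?thesis by (simp add: algebra_simps)
qed

lemma log_norm_measurable [measurable]:
  "(\<lambda>y::R4. ln (norm (x - y))) \<in> borel_measurable borel"
  by measurable

lemma G1_const_le_1: "1 / (8 * pi\<^sup>2) \<le> 1"
proof -
  have "1 \<le> pi" using pi_ge_two by linarith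
  then have "1 \<le> pi\<^sup>2" by (rule one_le_power)
  then show ?thesis by simp
qed

lemma norm_G1_le:
  "norm (G1 F x) \<le> norm (LINT y|lebesgue. complex_of_real (ln (norm (x - y))) * F y)"
proof -
  have "norm (G1 F x) = (1 / (8 * pi\<^sup>2)) * norm (LINT y|lebesgue. complex_of_real (ln (norm (x - y))) * F y)"
    unfolding G1_def norm_mult norm_minus_cancel norm_of_real by simp
  also have "\<dots> \<le> 1 * norm (LINT y|lebesgue. complex_of_real (ln (norm (x - y))) * F y)"
    by (intro mult_right_mono G1_const_le_1) simp
  finally show ?thesis by simp
qed

lemma G1_log_growth:
  assumes "log_bounded F M"
  shows "norm (G1 F x) \<le> (ln (jap x) + 1) * M"
proof -
  have "norm (LINT y|lebesgue. complex_of_real (ln (norm (x - y))) * F y) \<le> (ln (jap x) + 1) * M"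
    by (rule log_bounded_integral(2)[OF assms log_norm_measurable abs_log_le])
      (use ln_ge_zero[OF jap_ge_1, of x] in simp)
  then show ?thesis using norm_G1_le[of F x] by linarith
qed

text \<open>The cancellation that drives the whole argument: against a density of mean zero, any function of
  \<open>x\<close> alone can be subtracted from the kernel.\<close>
lemma log_integral_mean_zero:
  assumes F: "log_bounded F M" and mean: "(LINT y|lebesgue. F y) = 0"
  shows "(LINT y|lebesgue. complex_of_real (ln (norm (x - y))) * F y)
       = (LINT y|lebesgue. complex_of_real (ln (norm (x - y)) - ln (jap x)) * F y)"
proof -
  have i1: "integrable lebesgue (\<lambda>y. complex_of_real (ln (norm (x - y))) * F y)"
    by (rule log_bounded_integral(1)[OF F log_norm_measurable abs_log_le])
      (use ln_ge_zero[OF jap_ge_1, of x] in simp)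
  have "(LINT y|lebesgue. complex_of_real (ln (norm (x - y)) - ln (jap x)) * F y)
      = (LINT y|lebesgue. complex_of_real (ln (norm (x - y))) * F y - complex_of_real (ln (jap x)) * F y)"
    by (simp add: algebra_simps)
  also have "\<dots> = (LINT y|lebesgue. complex_of_real (ln (norm (x - y))) * F y) - complex_of_real (ln (jap x)) * (LINT y|lebesgue. F y)"
    using i1 log_bounded_integrable[OF F] by (subst Bochner_Integration.integral_diff) auto
  finally show ?thesis using mean by simp
qed

lemma G1_mean_zero_bounded:
  assumes F: "log_bounded F M" and mean: "(LINT y|lebesgue. F y) = 0"
  shows "norm (G1 F x) \<le> M"
proof -
  have "norm (LINT y|lebesgue. complex_of_real (ln (norm (x - y)) - ln (jap x)) * F y) \<le> 1 * M"
    by (rule log_bounded_integral(2)[where x = x, OF F]) (auto simp: log_kernel_bound)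
  then show ?thesis using norm_G1_le[of F x] log_integral_mean_zero[OF F mean, of x] by simp
qed

text \<open>With one more power of decay of the density, that power is transferred to the potential.\<close>
lemma G1_mean_zero_decay:
  assumes F: "log_bounded F M" and mean: "(LINT y|lebesgue. F y) = 0"
    and wF: "log_bounded (\<lambda>y. complex_of_real (jap y) * F y) M'"
  shows "norm (G1 F x) \<le> 8 * M' / jap x"
proof -
  have j: "0 < jap y" for y using jap_pos .
  have "norm (LINT y|lebesgue. complex_of_real ((ln (norm (x - y)) - ln (jap x)) / jap y) * (complex_of_real (jap y) * F y)) \<le> (8 / jap x) * M'"
  proof (rule log_bounded_integral(2)[where x = x, OF wF])
    show "\<bar>(ln (norm (x - y)) - ln (jap x)) / jap y\<bar> \<le> 8 / jap x * log_kernel x y" for y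
      using log_kernel_bound_decay[of x y] j[of y] j[of x]
      by (simp add: abs_divide divide_le_eq mult_ac)
  qed (use j in \<open>auto intro: less_imp_le\<close>)
  moreover have "complex_of_real ((ln (norm (x - y)) - ln (jap x)) / jap y) * (complex_of_real (jap y) * F y)
      = complex_of_real (ln (norm (x - y)) - ln (jap x)) * F y" for y
    using j[of y] by simp
  ultimately show ?thesis
    using norm_G1_le[of F x] log_integral_mean_zero[OF F mean, of x] by simp
qed

lemma G1_borel_eq:
  assumes [measurable]: "F \<in> borel_measurable borel"
  shows "G1 F x = - complex_of_real (1 / (8 * pi\<^sup>2)) * (LINT y|lborel. complex_of_real (ln (norm (x - y))) * F y)"
  unfolding G1_def by (subst integral_completion) auto

lemma G1_measurable:
  assumes "F \<in> borel_measurable lebesgue"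
  shows "G1 F \<in> borel_measurable borel"
proof -
  obtain F' where [measurable]: "F' \<in> borel_measurable borel" and "F =ae F'"
    using lebesgue_complex_borel_representative[OF assms] .
  then have "G1 F = G1 F'"
    using assms borel_imp_lebesgue_measurable[OF \<open>F' \<in> _\<close>] by (intro G1_cong_AE) auto
  also have "\<dots> \<in> borel_measurable borel"
    unfolding G1_borel_eq[OF \<open>F' \<in> _\<close>, abs_def] by measurable
  finally show ?thesis .
qed

text \<open>The kernel is symmetric, so this is Fubini's theorem; absolute convergence holds because the
  potential of the modulus grows at most logarithmically while \<open>g\<close> is bounded with
  bounded support.\<close>
lemma G1_symmetric:
  assumes F: "log_bounded F M"
    and g [measurable]: "g \<in> borel_measurable borel"
    and g_bound: "\<And>x. norm (g x) \<le> B * indicator (cball 0 R) x"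
  shows "(LINT x|lebesgue. G1 F x * g x) = (LINT y|lebesgue. F y * G1 g y)"
proof -
  have Fm: "F \<in> borel_measurable lebesgue" using F by (simp add: log_bounded_def)
  obtain F' where [measurable]: "F' \<in> borel_measurable borel" and ae: "F =ae F'"
    using lebesgue_complex_borel_representative[OF Fm] .
  have F'm: "F' \<in> borel_measurable lebesgue"
    by (rule borel_imp_lebesgue_measurable) measurable
  have F': "log_bounded F' M" by (rule log_bounded_AE[OF F F'm ae])
  have M: "0 \<le> M" using F by (simp add: log_bounded_def)
  define f where "f x y = g x * (complex_of_real (ln (norm (x - y))) * F' y)" for x y
  have [measurable]: "case_prod f \<in> borel_measurable (borel \<Otimes>\<^sub>M borel)"
    unfolding f_def[abs_def] case_prod_beta' by measurable
  have inner: "integrable lborel (\<lambda>y. complex_of_real (ln (norm (x - y))) * F' y)"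
    "(LINT y|lborel. norm (complex_of_real (ln (norm (x - y))) * F' y)) \<le> (ln (jap x) + 1) * M" for x
  proof -
    have "integrable lebesgue (\<lambda>y. complex_of_real (ln (norm (x - y))) * F' y)"
      "(LINT y|lebesgue. norm (complex_of_real (ln (norm (x - y))) * F' y)) \<le> (ln (jap x) + 1) * M"
      using log_bounded_integral(1,3)[OF F' log_norm_measurable abs_log_le, of x]
        ln_ge_zero[OF jap_ge_1, of x] by simp_all
    then show "integrable lborel (\<lambda>y. complex_of_real (ln (norm (x - y))) * F' y)"
      "(LINT y|lborel. norm (complex_of_real (ln (norm (x - y))) * F' y)) \<le> (ln (jap x) + 1) * M"
      by (auto simp: integrable_completion integral_completion)
  qed
  have int: "integrable (lborel \<Otimes>\<^sub>M lborel) (case_prod f)"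
  proof (rule lborel_pair.Fubini_integrable)
    show "case_prod f \<in> borel_measurable (lborel \<Otimes>\<^sub>M lborel)" by measurable
    show "AE x in lborel. integrable lborel (\<lambda>y. case_prod f (x, y))"
      unfolding f_def using inner(1) by auto
    have "integrable lborel (\<lambda>x. (B * ((ln (1 + \<bar>R\<bar>) + 1) * M)) * indicator (cball 0 R) (x::R4) :: real)"
      by (intro integrable_mult_right integrable_real_indicator) (use emeasure_bounded_finite[OF bounded_cball] in auto)
    then show "integrable lborel (\<lambda>x. LINT y|lborel. norm (case_prod f (x, y)))"
    proof (rule Bochner_Integration.integrable_bound)
      show "AE x in lborel. norm (LINT y|lborel. norm (case_prod f (x, y))) \<le> norm (B * ((ln (1 + \<bar>R\<bar>) + 1) * M) * indicator (cball 0 R) x)"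
      proof (rule AE_I2)
        fix x :: R4
        have "norm (LINT y|lborel. norm (case_prod f (x, y))) = norm (g x) * (LINT y|lborel. norm (complex_of_real (ln (norm (x - y))) * F' y))"
          unfolding f_def by (simp add: norm_mult flip: mult.assoc) (simp add: mult.assoc)
        also have "\<dots> \<le> B * indicator (cball 0 R) x * ((ln (jap x) + 1) * M)"
          using g_bound[of x] inner(2)[of x] order_trans[OF norm_ge_zero g_bound[of x]]
          by (intro mult_mono) auto
        also have "\<dots> \<le> B * ((ln (1 + \<bar>R\<bar>) + 1) * M) * indicator (cball 0 R) x"
        proof (cases "x \<in> cball 0 R")
          case True
          then have "0 \<le> B" using order_trans[OF norm_ge_zero g_bound[of x]] by simp
          moreover have "ln (jap x) \<le> ln (1 + \<bar>R\<bar>)"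
            using jap_le[of x] jap_pos[of x] True by (intro ln_mono) auto
          ultimately show ?thesis using True M by (auto intro!: mult_left_mono mult_right_mono)
        qed simp
        finally show "norm (LINT y|lborel. norm (case_prod f (x, y))) \<le> norm (B * ((ln (1 + \<bar>R\<bar>) + 1) * M) * indicator (cball 0 R) x)"
          by (smt (verit) real_norm_def)
      qed
    qed measurable
  qed
  define c where "c = - complex_of_real (1 / (8 * pi\<^sup>2))"
  have "(LINT x|lebesgue. G1 F x * g x) = (LINT x|lebesgue. G1 F' x * g x)"
    using G1_cong_AE[OF Fm F'm ae] by simp
  also have "\<dots> = (LINT x|lborel. G1 F' x * g x)"
    using G1_measurable[OF F'm] by (subst integral_completion) auto
  also have "\<dots> = c * (LINT x|lborel. (LINT y|lborel. f x y))"
  proof -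
    have "G1 F' x * g x = c * (LINT y|lborel. f x y)" for x
      unfolding f_def integral_mult_right_zero G1_borel_eq[OF \<open>F' \<in> borel_measurable borel\<close>] c_def
      by (simp only: mult_ac)
    then show ?thesis by simp
  qed
  also have "(LINT x|lborel. (LINT y|lborel. f x y)) = (LINT y|lborel. (LINT x|lborel. f x y))"
    by (rule lborel_pair.Fubini_integral[OF int, symmetric])
  also have "(LINT y|lborel. (LINT x|lborel. f x y)) = (LINT y|lborel. F' y * (LINT x|lborel. complex_of_real (ln (norm (y - x))) * g x))"
  proof -
    have "(LINT x|lborel. f x y) = (LINT x|lborel. F' y * (complex_of_real (ln (norm (y - x))) * g x))" for y
      unfolding f_def by (simp only: mult_ac norm_minus_commute[of y])
    then show ?thesis by simp
  qed
  also have "c * \<dots> = (LINT y|lborel. F' y * G1 g y)"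
  proof -
    have "F' y * G1 g y = c * (F' y * (LINT x|lborel. complex_of_real (ln (norm (y - x))) * g x))" for y
      unfolding G1_borel_eq[OF g] c_def by (simp only: mult_ac)
    then show ?thesis by (simp only: integral_mult_right_zero)
  qed
  also have "\<dots> = (LINT y|lebesgue. F' y * G1 g y)"
    using G1_measurable[OF borel_imp_lebesgue_measurable[OF g]] by (subst integral_completion) auto
  also have "\<dots> = (LINT y|lebesgue. F y * G1 g y)"
    using ae Fm F'm borel_imp_lebesgue_measurable[OF G1_measurable[OF borel_imp_lebesgue_measurable[OF g]]]
    by (intro integral_cong_AE) (auto elim: eventually_mono)
  finally show ?thesis .
qed

section \<open>Integration by parts\<close>

lemma integrable_continuous_cball:
  fixes f :: "'a::euclidean_space \<Rightarrow> 'b::{banach, second_countable_topology}"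
  assumes "continuous_on UNIV f" and "\<And>x. x \<notin> cball 0 R \<Longrightarrow> f x = 0"
  shows "integrable lborel f"
proof -
  have "integrable lborel (\<lambda>x. indicator (cball 0 R) x *\<^sub>R f x)"
    by (rule borel_integrable_compact) (auto intro: continuous_on_subset[OF assms(1)])
  also have "(\<lambda>x. indicator (cball 0 R) x *\<^sub>R f x) = f"
    using assms(2) by (auto simp: indicator_def fun_eq_iff)
  finally show ?thesis .
qed

lemma continuous_cball_bounded:
  fixes f :: "'a::euclidean_space \<Rightarrow> 'b::real_normed_vector"
  assumes "continuous_on UNIV f" and "\<And>x. x \<notin> cball 0 R \<Longrightarrow> f x = 0"
  obtains B where "0 \<le> B" "\<And>x. norm (f x) \<le> B * indicator (cball 0 R) x" "\<And>x. norm (f x) \<le> B"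
proof -
  have "compact (f ` cball 0 R)"
    by (intro compact_continuous_image continuous_on_subset[OF assms(1)]) auto
  then obtain B where B: "B > 0" "\<And>x. x \<in> cball 0 R \<Longrightarrow> norm (f x) \<le> B"
    using compact_imp_bounded bounded_pos by (metis imageI)
  show ?thesis
  proof
    show "0 \<le> B" using B by simp
    show "norm (f x) \<le> B * indicator (cball 0 R) x" for x
      using B(2)[of x] assms(2)[of x] by (cases "x \<in> cball 0 R") auto
    show "norm (f x) \<le> B" for x
      using B assms(2)[of x] by (cases "x \<in> cball 0 R") auto
  qed
qed

lemma partial_eqI: "(f has_derivative f') (at x) \<Longrightarrow> partial i f x = f' i"
  unfolding partial_def by (metis frechet_derivative_at)

lemma partial_outside:
  assumes "\<And>x. x \<notin> cball 0 R \<Longrightarrow> f x = 0" "x \<notin> cball 0 R"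
  shows "partial i f x = 0"
proof -
  have "(f has_derivative (\<lambda>_. 0)) (at x)"
    by (rule has_derivative_transform_within_open[of "\<lambda>_. 0" _ _ _ "- cball 0 R"])
      (use assms in \<open>auto simp: open_Compl\<close>)
  then show ?thesis by (rule partial_eqI)
qed

text \<open>The difference quotients in direction \<open>i\<close> have integral zero by translation invariance,
  and converge to the derivative dominatedly, since the derivative is bounded.\<close>
lemma integral_partial_eq_0:
  assumes diff: "\<And>x. f differentiable (at x)"
    and cont: "continuous_on UNIV (partial i f)"
    and supp: "\<And>x. x \<notin> cball 0 R \<Longrightarrow> f x = 0"
  shows "(LINT x|lborel. partial i f x) = 0"
proof -
  have cf: "continuous_on UNIV f"
    using diff by (simp add: differentiable_imp_continuous_within continuous_on_eq_continuous_within)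
  have intf: "integrable lborel f" by (rule integrable_continuous_cball[OF cf supp])
  have [measurable]: "f \<in> borel_measurable borel" "partial i f \<in> borel_measurable borel"
    using cf cont by (auto intro: borel_measurable_continuous_onI)
  obtain B where B: "0 \<le> B" "\<And>x. norm (partial i f x) \<le> B"
    by (rule continuous_cball_bounded[OF cont]) (auto intro: partial_outside supp)
  define h where "h n = inverse (real (Suc n))" for n
  have h: "0 < h n" "h n \<le> 1" for n by (auto simp: h_def field_simps)
  have h0: "h \<longlonglongrightarrow> 0" unfolding h_def by (rule LIMSEQ_inverse_real_of_nat)
  define s where "s n x = (f (x + h n *\<^sub>R i) - f x) /\<^sub>R h n" for n x
  have line: "((\<lambda>t. f (x + t *\<^sub>R i)) has_derivative (\<lambda>t. t *\<^sub>R partial i f (x + u *\<^sub>R i))) (at u)" for x u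
  proof -
    have d: "(f has_derivative frechet_derivative f (at (x + u *\<^sub>R i))) (at (x + u *\<^sub>R i))"
      using diff frechet_derivative_works by blast
    have "((\<lambda>t. x + t *\<^sub>R i) has_derivative (\<lambda>t. t *\<^sub>R i)) (at u)"
      by (auto intro!: derivative_eq_intros)
    from diff_chain_at[OF this d]
    have "((\<lambda>t. f (x + t *\<^sub>R i)) has_derivative (\<lambda>t. frechet_derivative f (at (x + u *\<^sub>R i)) (t *\<^sub>R i))) (at u)"
      by (simp add: o_def)
    moreover have "frechet_derivative f (at (x + u *\<^sub>R i)) (t *\<^sub>R i) = t *\<^sub>R partial i f (x + u *\<^sub>R i)" for t
      using linear_frechet_derivative[OF diff] by (simp add: partial_def linear_cmul)
    ultimately show ?thesis by simp
  qed
  have lim: "(\<lambda>n. s n x) \<longlonglongrightarrow> partial i f x" for x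
  proof -
    have "((\<lambda>t. f (x + t *\<^sub>R i)) has_vector_derivative partial i f x) (at 0)"
      using line[of x 0] by (simp add: has_vector_derivative_def)
    then have "((\<lambda>t. norm (f (x + t *\<^sub>R i) - f x - t *\<^sub>R partial i f x) / \<bar>t\<bar>) \<longlongrightarrow> 0) (at 0)"
      by (simp add: has_vector_derivative_def has_derivative_at)
    then have "((\<lambda>t. norm ((f (x + t *\<^sub>R i) - f x) /\<^sub>R t - partial i f x)) \<longlongrightarrow> 0) (at 0)"
    proof (rule Lim_transform_eventually)
      show "\<forall>\<^sub>F t in at 0. norm (f (x + t *\<^sub>R i) - f x - t *\<^sub>R partial i f x) / \<bar>t\<bar> = norm ((f (x + t *\<^sub>R i) - f x) /\<^sub>R t - partial i f x)"
        unfolding eventually_at_filter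
      proof (intro always_eventually allI impI)
        fix t :: real assume "t \<noteq> 0"
        then have "(t *\<^sub>R partial i f x) /\<^sub>R t = partial i f x"
          by simp
        then have *: "(f (x + t *\<^sub>R i) - f x) /\<^sub>R t - partial i f x = (f (x + t *\<^sub>R i) - f x - t *\<^sub>R partial i f x) /\<^sub>R t"
          by (simp only: scaleR_diff_right)
        show "norm (f (x + t *\<^sub>R i) - f x - t *\<^sub>R partial i f x) / \<bar>t\<bar> = norm ((f (x + t *\<^sub>R i) - f x) /\<^sub>R t - partial i f x)"
          unfolding * norm_scaleR by (simp only: abs_inverse divide_inverse mult.commute)
      qed
    qed
    from LIM_zero_cancel[OF tendsto_norm_zero_cancel[OF this]]
    have "((\<lambda>t. (f (x + t *\<^sub>R i) - f x) /\<^sub>R t) \<longlongrightarrow> partial i f x) (at 0)" .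
    moreover have "filterlim h (at 0) sequentially"
      using h h0 by (auto simp: filterlim_at intro!: always_eventually less_imp_neq[symmetric])
    ultimately show ?thesis
      unfolding s_def by (rule filterlim_compose)
  qed
  have bound: "norm (s n x) \<le> B * indicator (cball 0 (\<bar>R\<bar> + norm i)) x" for n x
  proof (cases "x \<in> cball 0 (\<bar>R\<bar> + norm i)")
    case True
    have "norm (f (x + h n *\<^sub>R i) - f (x + 0 *\<^sub>R i)) \<le> B * norm (h n - 0)"
    proof (rule differentiable_bound[where S = UNIV])
      show "((\<lambda>t. f (x + t *\<^sub>R i)) has_derivative (\<lambda>t. t *\<^sub>R partial i f (x + u *\<^sub>R i))) (at u within UNIV)" for u
        using line by simp
      show "onorm (\<lambda>t. t *\<^sub>R partial i f (x + u *\<^sub>R i)) \<le> B" for u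
        using B(2) by (intro onorm_le) (simp add: mult.commute[of B] mult_left_mono)
    qed auto
    then show ?thesis
      using True h[of n] by (simp add: s_def divide_simps mult.commute)
  next
    case False
    have "norm (h n *\<^sub>R i) \<le> norm i"
      using h[of n] by (simp add: mult_left_le_one_le)
    then have "R < norm (x + h n *\<^sub>R i)" "R < norm x"
      using False norm_diff_ineq[of x "h n *\<^sub>R i"] norm_ge_zero[of i] unfolding mem_cball_0 by linarith+
    then show ?thesis using False supp by (simp add: s_def)
  qed
  have "(LINT x|lborel. s n x) = 0" for n
  proof -
    have t: "(LINT x|lborel. f (x + h n *\<^sub>R i)) = (LINT x|lborel. f x)" "integrable lborel (\<lambda>x. f (x + h n *\<^sub>R i))"
    proof -
      have "(LINT x|lborel. f x) = (LINT x|distr lborel borel ((+) (h n *\<^sub>R i)). f x)"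
        by (simp add: lborel_distr_plus)
      also have "\<dots> = (LINT x|lborel. f (x + h n *\<^sub>R i))"
        by (subst integral_distr) (auto simp: add.commute)
      finally show "(LINT x|lborel. f (x + h n *\<^sub>R i)) = (LINT x|lborel. f x)" ..
      have "integrable (distr lborel borel ((+) (h n *\<^sub>R i))) f"
        using intf by (simp add: lborel_distr_plus)
      then show "integrable lborel (\<lambda>x. f (x + h n *\<^sub>R i))"
        by (subst (asm) integrable_distr_eq) (auto simp: add.commute)
    qed
    show ?thesis unfolding s_def using t intf by simp
  qed
  moreover have "(\<lambda>n. LINT x|lborel. s n x) \<longlonglongrightarrow> (LINT x|lborel. partial i f x)"
  proof (rule integral_dominated_convergence)
    show "integrable lborel (\<lambda>x. B * indicator (cball 0 (\<bar>R\<bar> + norm i)) (x::R4) :: real)"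
      by (intro integrable_mult_right integrable_real_indicator) (use emeasure_bounded_finite[OF bounded_cball] in auto)
  qed (use lim bound in \<open>auto simp: s_def\<close>)
  ultimately show ?thesis by (simp add: LIMSEQ_const_iff)
qed

lemma Ck_imp_continuous: "Ck k f \<Longrightarrow> continuous_on UNIV f"
  by (cases k) (auto simp: differentiable_imp_continuous_within continuous_on_eq_continuous_within)

lemma Ck_Suc_imp_Ck: "Ck (Suc k) f \<Longrightarrow> Ck k f"
proof (induction k arbitrary: f)
  case 0
  then show ?case using Ck_imp_continuous by (metis Ck.simps(1))
qed auto

lemma integration_by_parts:
  assumes u: "Ck (Suc 0) u" and w: "Ck (Suc 0) w" and i: "i \<in> Basis"
    and supp: "\<And>x. x \<notin> cball 0 R \<Longrightarrow> w x = 0"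
  shows "(LINT x|lborel. u x * partial i w x) = - (LINT x|lborel. partial i u x * w x)"
proof -
  have c: "continuous_on UNIV u" "continuous_on UNIV w" "continuous_on UNIV (partial i u)" "continuous_on UNIV (partial i w)"
    using u w i by (auto intro!: Ck_imp_continuous[OF u] Ck_imp_continuous[OF w])
  have d: "((\<lambda>x. u x * w x) has_derivative (\<lambda>h. u x * frechet_derivative w (at x) h + frechet_derivative u (at x) h * w x)) (at x)" for x
    using u w by (intro has_derivative_mult) (auto simp flip: frechet_derivative_works)
  have p: "partial i (\<lambda>x. u x * w x) = (\<lambda>x. u x * partial i w x + partial i u x * w x)"
    using partial_eqI[OF d] by (auto simp: partial_def)
  have int: "integrable lborel (\<lambda>x. u x * partial i w x)" "integrable lborel (\<lambda>x. partial i u x * w x)"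
    by (rule integrable_continuous_cball[where R = R];
        use c supp partial_outside[where R = R and f = w and i = i] in \<open>auto intro!: continuous_intros\<close>)+
  have "(LINT x|lborel. partial i (\<lambda>x. u x * w x) x) = 0"
  proof (rule integral_partial_eq_0)
    show "(\<lambda>x. u x * w x) differentiable at x" for x
      using d differentiable_def by blast
    show "continuous_on UNIV (partial i (\<lambda>x. u x * w x))"
      unfolding p using c by (intro continuous_intros)
  qed (use supp in auto)
  then show ?thesis
    unfolding p using int by (simp add: add_eq_0_iff)
qed

text \<open>Only the function on the right of each product has bounded support, so the boundary terms vanish
  even though \<open>u\<close> need not decay.\<close>
lemma green_identity:
  assumes u: "Ck (Suc (Suc 0)) u" and w: "Ck (Suc (Suc 0)) w"
    and supp: "\<And>x. x \<notin> cball 0 R \<Longrightarrow> w x = 0"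
  shows "(LINT x|lborel. u x * laplacian w x) = (LINT x|lborel. laplacian u x * w x)"
proof -
  have p: "Ck (Suc 0) (partial i u)" "Ck (Suc 0) (partial i w)" if "i \<in> Basis" for i
    using u w that by auto
  have u1: "Ck (Suc 0) u" and w1: "Ck (Suc 0) w"
    using u w Ck_Suc_imp_Ck by blast+
  have c: "continuous_on UNIV u" "continuous_on UNIV w" using u w Ck_imp_continuous by blast+
  have c2: "continuous_on UNIV (partial i (partial i u))" "continuous_on UNIV (partial i (partial i w))" if "i \<in> Basis" for i
    using p[OF that] that by auto
  have supp2: "partial i w x = 0" "partial i (partial i w) x = 0" if "x \<notin> cball 0 R" for x i
    using supp that partial_outside[where R = R] by blast+
  have int: "integrable lborel (\<lambda>x. u x * partial i (partial i w) x)" "integrable lborel (\<lambda>x. partial i (partial i u) x * w x)" if "i \<in> Basis" for i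
    by (rule integrable_continuous_cball[where R = R];
        use c c2[OF that] supp supp2 in \<open>auto intro!: continuous_intros\<close>)+
  have "(LINT x|lborel. u x * laplacian w x) = (\<Sum>i\<in>Basis. LINT x|lborel. u x * partial i (partial i w) x)"
    unfolding laplacian_def sum_distrib_left using int by (subst Bochner_Integration.integral_sum) auto
  also have "\<dots> = (\<Sum>i\<in>Basis. LINT x|lborel. partial i (partial i u) x * w x)"
  proof (rule sum.cong)
    fix i :: R4 assume i: "i \<in> Basis"
    have "(LINT x|lborel. u x * partial i (partial i w) x) = - (LINT x|lborel. partial i u x * partial i w x)"
      by (rule integration_by_parts[OF u1 p(2)[OF i] i supp2(1)])
    also have "\<dots> = (LINT x|lborel. partial i (partial i u) x * w x)"
      by (subst integration_by_parts[OF p(1)[OF i] w1 i supp]) auto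
    finally show "(LINT x|lborel. u x * partial i (partial i w) x) = (LINT x|lborel. partial i (partial i u) x * w x)" .
  qed simp
  also have "\<dots> = (LINT x|lborel. laplacian u x * w x)"
    unfolding laplacian_def sum_distrib_right using int by (subst Bochner_Integration.integral_sum) auto
  finally show ?thesis .
qed

lemma partial_add:
  assumes "f differentiable (at x)" "g differentiable (at x)"
  shows "partial i (\<lambda>x. f x + g x) x = partial i f x + partial i g x"
proof -
  have "((\<lambda>x. f x + g x) has_derivative (\<lambda>h. frechet_derivative f (at x) h + frechet_derivative g (at x) h)) (at x)"
    using assms by (intro has_derivative_add) (auto simp flip: frechet_derivative_works)
  from partial_eqI[OF this] show ?thesis by (simp add: partial_def)
qed

lemma Ck_add: "Ck k f \<Longrightarrow> Ck k g \<Longrightarrow> Ck k (\<lambda>x. f x + g x)"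
proof (induction k arbitrary: f g)
  case (Suc k)
  have "partial i (\<lambda>x. f x + g x) = (\<lambda>x. partial i f x + partial i g x)" for i
    using Suc.prems by (auto intro!: partial_add)
  then show ?case using Suc by auto
qed (auto intro: continuous_on_add)

lemma partial_const [simp]: "partial i (\<lambda>x. c) = (\<lambda>x. 0)"
  by (rule ext, rule partial_eqI[OF has_derivative_const])

lemma Ck_const: "Ck k (\<lambda>x. c)"
  by (induction k arbitrary: c) auto

lemma Ck_sum: "finite A \<Longrightarrow> (\<And>a. a \<in> A \<Longrightarrow> Ck k (f a)) \<Longrightarrow> Ck k (\<lambda>x. \<Sum>a\<in>A. f a x)"
  by (induction A rule: finite_induct) (auto intro: Ck_add Ck_const)

lemma Ck_laplacian: "Ck (Suc (Suc k)) f \<Longrightarrow> Ck k (laplacian f)"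
  unfolding laplacian_def[abs_def] by (intro Ck_sum) auto

lemma laplacian_outside:
  assumes "\<And>x. x \<notin> cball 0 R \<Longrightarrow> f x = 0" "x \<notin> cball 0 R"
  shows "laplacian f x = 0"
proof -
  have "partial i f x = 0" if "x \<notin> cball 0 R" for i x
    using partial_outside assms(1) that by blast
  then have "partial i (partial i f) x = 0" for i
    using partial_outside assms(2) by blast
  then show ?thesis by (simp add: laplacian_def)
qed

section \<open>The fundamental solution of the bilaplacian\<close>

text \<open>In dimension 4 the Laplacian of \<open>g(s)\<close> with \<open>s = |x - y|\<^sup>2\<close> is
  \<open>4 s g'' + 8 g'\<close>; the squared distance is used instead of the distance because it is
  smooth at \<open>y\<close>.\<close>
lemma radial_Ck2_laplacian:
  fixes g g' g'' :: "real \<Rightarrow> real" and y :: R4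
  assumes g: "\<And>s. 0 \<le> s \<Longrightarrow> (g has_real_derivative g' s) (at s)"
    and g': "\<And>s. 0 \<le> s \<Longrightarrow> (g' has_real_derivative g'' s) (at s)"
    and g'': "continuous_on {0..} g''"
  defines "u \<equiv> \<lambda>x. complex_of_real (g ((norm (x - y))\<^sup>2))"
  shows "Ck (Suc (Suc 0)) u"
    and "laplacian u x = complex_of_real (4 * (norm (x - y))\<^sup>2 * g'' ((norm (x - y))\<^sup>2) + 8 * g' ((norm (x - y))\<^sup>2))"
proof -
  define q where "q x = (norm (x - y))\<^sup>2" for x
  have q0: "0 \<le> q x" for x by (simp add: q_def)
  have q': "(q has_derivative (\<lambda>h. 2 * ((x - y) \<bullet> h))) (at x)" for x
    unfolding q_def[abs_def] power2_norm_eq_inner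
    by (auto intro!: derivative_eq_intros simp: inner_commute)
  have comp: "((\<lambda>x. f (q x)) has_derivative (\<lambda>h. 2 * ((x - y) \<bullet> h) * f' (q x))) (at x)"
    if "\<And>s. 0 \<le> s \<Longrightarrow> (f has_real_derivative f' s) (at s)" for f f' x
    using diff_chain_at[OF q'[of x] that[OF q0, of x, THEN has_field_derivative_imp_has_derivative]]
    by (simp add: o_def mult.commute)
  have d1: "(u has_derivative (\<lambda>h. complex_of_real (2 * ((x - y) \<bullet> h) * g' (q x)))) (at x)" for x
    using bounded_linear.has_derivative[OF bounded_linear_of_real comp[OF g]] by (simp add: u_def q_def)
  have p1: "partial i u = (\<lambda>x. complex_of_real (2 * ((x - y) \<bullet> i) * g' (q x)))" for i
    using partial_eqI[OF d1] by auto
  have d2: "(partial i u has_derivative (\<lambda>h. complex_of_real (2 * (h \<bullet> i) * g' (q x) + 2 * ((x - y) \<bullet> i) * (2 * ((x - y) \<bullet> h) * g'' (q x))))) (at x)" for i x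
  proof -
    have "((\<lambda>x. 2 * ((x - y) \<bullet> i) * g' (q x)) has_derivative
      (\<lambda>h. 2 * ((x - y) \<bullet> i) * (2 * ((x - y) \<bullet> h) * g'' (q x)) + 2 * (h \<bullet> i) * g' (q x))) (at x)"
      by (rule has_derivative_mult[OF _ comp[OF g']]) (auto intro!: derivative_eq_intros)
    from bounded_linear.has_derivative[OF bounded_linear_of_real this]
    show ?thesis unfolding p1 by (simp add: add.commute)
  qed
  have p2: "partial j (partial i u) = (\<lambda>x. complex_of_real (2 * (j \<bullet> i) * g' (q x) + 2 * ((x - y) \<bullet> i) * (2 * ((x - y) \<bullet> j) * g'' (q x))))" for i j
    using partial_eqI[OF d2] by auto
  have cq: "continuous_on UNIV q" unfolding q_def[abs_def] by (intro continuous_intros)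
  have cg': "continuous_on {0..} g'"
    using g' by (auto intro!: continuous_at_imp_continuous_on DERIV_isCont)
  have "continuous_on UNIV (\<lambda>x. g' (q x))" "continuous_on UNIV (\<lambda>x. g'' (q x))"
    using continuous_on_compose2[OF cg' cq] continuous_on_compose2[OF g'' cq] q0 by auto
  then have "continuous_on UNIV (partial j (partial i u))" for i j
    unfolding p2 by (intro continuous_intros)
  then show "Ck (Suc (Suc 0)) u"
    using differentiableI[OF d1] differentiableI[OF d2] by auto
  have "laplacian u x = complex_of_real (\<Sum>i\<in>Basis. 2 * (i \<bullet> i) * g' (q x) + 2 * ((x - y) \<bullet> i) * (2 * ((x - y) \<bullet> i) * g'' (q x)))"
    unfolding laplacian_def p2 by simp
  also have "(\<Sum>i\<in>Basis. 2 * (i \<bullet> i) * g' (q x) + 2 * ((x - y) \<bullet> i) * (2 * ((x - y) \<bullet> i) * g'' (q x)))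
    = (\<Sum>i\<in>(Basis::R4 set). 2 * g' (q x)) + 4 * g'' (q x) * (\<Sum>i\<in>Basis. ((x - y) \<bullet> i)\<^sup>2)"
    by (simp add: sum.distrib sum_distrib_left power2_eq_square mult_ac inner_Basis)
  also have "(\<Sum>i\<in>Basis. ((x - y) \<bullet> i)\<^sup>2) = q x"
    unfolding q_def power2_norm_eq_inner by (subst (2) euclidean_inner) (simp add: power2_eq_square)
  also have "(\<Sum>i\<in>(Basis::R4 set). 2 * g' (q x)) = 8 * g' (q x)"
    by simp
  finally show "laplacian u x = complex_of_real (4 * (norm (x - y))\<^sup>2 * g'' ((norm (x - y))\<^sup>2) + 8 * g' ((norm (x - y))\<^sup>2))"
    by (simp add: q_def algebra_simps)
qed

text \<open>Here \<open>ln (s + d) / 2\<close>, with \<open>s = |x - y|\<^sup>2\<close>, is a smooth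
  approximation of \<open>ln |x - y|\<close>. Its Laplacian is \<open>2 / (s + d) + 2 d / (s +
  d)\<^sup>2\<close>, and the singular terms of the second Laplacian cancel, leaving a concentrating
  bump of fixed mass.\<close>
lemma bilaplacian_regularized_log:
  fixes d :: real and y :: R4
  assumes d: "0 < d"
  defines "u \<equiv> \<lambda>x. complex_of_real (ln ((norm (x - y))\<^sup>2 + d) / 2)"
  shows "Ck (Suc (Suc 0)) u" "Ck (Suc (Suc 0)) (laplacian u)"
    "laplacian (laplacian u) x = complex_of_real (- 48 * d\<^sup>2 / ((norm (x - y))\<^sup>2 + d) ^ 4)"
proof -
  \<comment> \<open>All derivatives are polynomials in \<open>r\<close>, and \<open>s * r s = 1 - d * r s\<close> eliminates \<open>s\<close>.\<close>
  define r where "r s = inverse (s + d)" for s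
  have nz: "s + d \<noteq> 0" if "0 \<le> s" for s :: real using that d by linarith
  have r': "(r has_real_derivative - ((r s)\<^sup>2)) (at s)" if "0 \<le> s" for s
    unfolding r_def[abs_def] using nz[OF that] by (auto intro!: derivative_eq_intros simp: power2_eq_square)
  have cr: "continuous_on {0..} r"
    unfolding r_def[abs_def] using nz by (intro continuous_intros) auto
  have rs: "s * r s = 1 - d * r s" if "0 \<le> s" for s
    unfolding r_def using nz[OF that] by (simp add: field_simps)
  define g where "g s = ln (s + d) / 2" for s
  have g: "(g has_real_derivative r s / 2) (at s)" if "0 \<le> s" for s
  proof -
    have "((\<lambda>s. ln (s + d)) has_real_derivative inverse (s + d)) (at s)"
      using that d by (auto intro!: derivative_eq_intros simp: inverse_eq_divide)
    from DERIV_cdivide[OF this, of 2] show ?thesis unfolding g_def[abs_def] r_def .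
  qed
  have g': "((\<lambda>s. r s / 2) has_real_derivative - ((r s)\<^sup>2) / 2) (at s)" if "0 \<le> s" for s
    by (intro DERIV_cdivide r' that)
  have cg: "continuous_on {0..} (\<lambda>s. - ((r s)\<^sup>2) / 2)"
    by (intro continuous_intros cr) auto
  have u: "u = (\<lambda>x. complex_of_real (g ((norm (x - y))\<^sup>2)))" by (simp add: u_def g_def)
  show "Ck (Suc (Suc 0)) u"
    unfolding u by (rule radial_Ck2_laplacian(1)[OF g g' cg])
  define k where "k s = 2 * r s + 2 * d * (r s)\<^sup>2" for s
  have k: "(k has_real_derivative - 2 * (r s)\<^sup>2 - 4 * d * (r s) ^ 3) (at s)" if "0 \<le> s" for s
  proof -
    have "(k has_real_derivative 2 * (- ((r s)\<^sup>2)) + 2 * d * (2 * r s * (- ((r s)\<^sup>2)))) (at s)"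
      unfolding k_def[abs_def]
      by (rule derivative_eq_intros r'[OF that] refl)+ simp
    then show ?thesis by (simp add: power2_eq_square power3_eq_cube mult_ac)
  qed
  have k': "((\<lambda>s. - 2 * (r s)\<^sup>2 - 4 * d * (r s) ^ 3) has_real_derivative 4 * (r s) ^ 3 + 12 * d * (r s) ^ 4) (at s)" if "0 \<le> s" for s
  proof -
    have "((\<lambda>s. - 2 * (r s)\<^sup>2 - 4 * d * (r s) ^ 3) has_real_derivative - 2 * (2 * r s * (- ((r s)\<^sup>2))) - 4 * d * (3 * (r s)\<^sup>2 * (- ((r s)\<^sup>2)))) (at s)"
      by (rule derivative_eq_intros r'[OF that] refl)+ simp
    then show ?thesis by (simp add: eval_nat_numeral mult_ac)
  qed
  have ck: "continuous_on {0..} (\<lambda>s. 4 * (r s) ^ 3 + 12 * d * (r s) ^ 4)"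
    by (intro continuous_intros cr)
  have lu: "laplacian u = (\<lambda>x. complex_of_real (k ((norm (x - y))\<^sup>2)))"
  proof
    fix x
    define s where "s = (norm (x - y))\<^sup>2"
    have s: "0 \<le> s" by (simp add: s_def)
    have "laplacian u x = complex_of_real (4 * s * (- ((r s)\<^sup>2) / 2) + 8 * (r s / 2))"
      unfolding u s_def by (rule radial_Ck2_laplacian(2)[OF g g' cg])
    also have "4 * s * (- ((r s)\<^sup>2) / 2) + 8 * (r s / 2) = - 2 * (s * r s) * r s + 4 * r s"
      by (simp add: power2_eq_square)
    also have "\<dots> = k s" unfolding rs[OF s] k_def by (simp add: power2_eq_square algebra_simps)
    finally show "laplacian u x = complex_of_real (k ((norm (x - y))\<^sup>2))" by (simp add: s_def)
  qed
  show "Ck (Suc (Suc 0)) (laplacian u)"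
    unfolding lu by (rule radial_Ck2_laplacian(1)[OF k k' ck])
  define s where "s = (norm (x - y))\<^sup>2"
  have s: "0 \<le> s" by (simp add: s_def)
  have "laplacian (laplacian u) x = complex_of_real (4 * s * (4 * (r s) ^ 3 + 12 * d * (r s) ^ 4) + 8 * (- 2 * (r s)\<^sup>2 - 4 * d * (r s) ^ 3))"
    unfolding lu s_def by (rule radial_Ck2_laplacian(2)[OF k k' ck])
  also have "4 * s * (4 * (r s) ^ 3 + 12 * d * (r s) ^ 4) + 8 * (- 2 * (r s)\<^sup>2 - 4 * d * (r s) ^ 3)
    = 16 * (s * r s) * (r s)\<^sup>2 + 48 * d * (s * r s) * (r s) ^ 3 - 16 * (r s)\<^sup>2 - 32 * d * (r s) ^ 3"
    by (simp add: eval_nat_numeral algebra_simps)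
  also have "\<dots> = - 48 * d\<^sup>2 * (r s) ^ 4"
    unfolding rs[OF s] by algebra
  also have "\<dots> = - 48 * d\<^sup>2 / (s + d) ^ 4"
    by (simp add: r_def divide_inverse power_inverse)
  finally show "laplacian (laplacian u) x = complex_of_real (- 48 * d\<^sup>2 / ((norm (x - y))\<^sup>2 + d) ^ 4)"
    by (simp add: s_def)
qed

lemma integral_laplacian_eq_0:
  assumes w: "Ck (Suc (Suc 0)) w" and supp: "\<And>x. x \<notin> cball 0 R \<Longrightarrow> w x = 0"
  shows "(LINT x|lborel. laplacian w x) = 0"
  using green_identity[OF Ck_const[of _ 1] w supp] by (simp add: laplacian_def)

lemma log_bounded_continuous_cball:
  assumes c: "continuous_on UNIV g" and supp: "\<And>x. x \<notin> cball 0 R \<Longrightarrow> g x = 0"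
  shows "\<exists>M. log_bounded g M"
proof -
  have gb [measurable]: "g \<in> borel_measurable borel"
    by (rule borel_measurable_continuous_onI[OF c])
  obtain B where B: "0 \<le> B" "\<And>x. norm (g x) \<le> B * indicator (cball 0 R) x"
    by (rule continuous_cball_bounded[OF c supp]) auto
  have "integrable lborel (\<lambda>x. B\<^sup>2 * indicator (cball 0 R) (x::R4) :: real)"
    by (intro integrable_mult_right integrable_real_indicator) (use emeasure_bounded_finite[OF bounded_cball] in auto)
  then have "integrable lborel (\<lambda>x. (norm (g x))\<^sup>2)"
  proof (rule Bochner_Integration.integrable_bound)
    show "AE x in lborel. norm ((norm (g x))\<^sup>2) \<le> norm (B\<^sup>2 * indicator (cball 0 R) x)"
    proof (rule AE_I2)
      fix x :: R4
      show "norm ((norm (g x))\<^sup>2) \<le> norm (B\<^sup>2 * indicator (cball 0 R) x)"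
      proof (cases "x \<in> cball 0 R")
        case True
        then have "norm (g x) \<le> B" using B(2)[of x] by simp
        then show ?thesis using True power_mono[of "norm (g x)" B 2] by simp
      qed (use supp in simp)
    qed
  qed measurable
  then have "g \<in> Lp 2"
    using borel_imp_lebesgue_measurable[OF gb] by (simp add: Lp_2_iff integrable_completion)
  moreover have "decays 2 (indicator (cball 0 R))"
  proof -
    have "\<bar>indicator (cball 0 R) x\<bar> \<le> (1 + \<bar>R\<bar>) powr 3 * jap x powr (- 2 - 1)" for x :: R4
    proof (cases "x \<in> cball 0 R")
      case True
      then have "jap x \<le> 1 + \<bar>R\<bar>" using jap_le[of x] by simp
      then have "jap x powr 3 \<le> (1 + \<bar>R\<bar>) powr 3"
        using jap_pos[of x] by (intro powr_mono2) auto
      then have "1 \<le> (1 + \<bar>R\<bar>) powr 3 / jap x powr 3"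
        using jap_pos[of x] by simp
      then show ?thesis using True by (simp add: powr_minus divide_inverse del: powr_numeral)
    qed simp
    then show ?thesis unfolding decays_def
      by (intro exI[of _ "(1 + \<bar>R\<bar>) powr 3"] conjI exI[of _ 1]) (auto simp del: powr_numeral)
  qed
  ultimately obtain M where "log_bounded (\<lambda>x. complex_of_real (indicator (cball 0 R) x) * g x) M"
    using log_bounded_weight[of "indicator (cball 0 R)" g]
      borel_imp_lebesgue_measurable[OF borel_measurable_indicator[OF borel_closed[OF closed_cball]]] by blast
  also have "(\<lambda>x. complex_of_real (indicator (cball 0 R) x) * g x) = g"
    using supp by (auto simp: indicator_def fun_eq_iff)
  finally show ?thesis ..
qed

lemma lborel_integral_affine:
  fixes f :: "'a::euclidean_space \<Rightarrow> 'b::{banach, second_countable_topology}"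
  assumes [measurable]: "f \<in> borel_measurable borel" and c: "0 < c"
  shows "(LINT x|lborel. f x) = (LINT z|lborel. (c ^ DIM('a)) *\<^sub>R f (y + c *\<^sub>R z))"
proof -
  have "(LINT x|lborel. f x) = (LINT x|density (distr lborel borel (\<lambda>x. y + c *\<^sub>R x)) (\<lambda>_. ennreal (c ^ DIM('a))). f x)"
    using lborel_affine[of c y] c by simp
  also have "\<dots> = (LINT z|lborel. (c ^ DIM('a)) *\<^sub>R f (y + c *\<^sub>R z))"
    using c by (subst integral_density) (auto simp: integral_distr)
  finally show ?thesis .
qed

lemma biharmonic_profile_integral:
  "integrable lborel (\<lambda>z::R4. 1 / (1 + (norm z)\<^sup>2) ^ 4)"
  "(LINT z::R4|lborel. 1 / (1 + (norm z)\<^sup>2) ^ 4) = pi\<^sup>2 / 6"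
proof -
  have "has_bochner_integral lborel (\<lambda>z::R4. 1 / (1 + (norm z)\<^sup>2) ^ 4) (pi\<^sup>2 / 6)"
    by (rule has_bochner_integral_nn_integral) (use nn_integral_biharmonic_profile in auto)
  then show "integrable lborel (\<lambda>z::R4. 1 / (1 + (norm z)\<^sup>2) ^ 4)"
    "(LINT z::R4|lborel. 1 / (1 + (norm z)\<^sup>2) ^ 4) = pi\<^sup>2 / 6"
    by (auto simp: has_bochner_integral_iff)
qed

text \<open>Rescaling \<open>x = y + d n z\<close> turns the bump into a fixed integrable profile and moves the
  scale into the argument of \<open>\<eta>\<close>, where continuity yields the limit.\<close>
lemma biharmonic_approximate_identity:
  fixes \<eta> :: "R4 \<Rightarrow> complex"
  assumes c: "continuous_on UNIV \<eta>" and supp: "\<And>x. x \<notin> cball 0 R \<Longrightarrow> \<eta> x = 0"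
    and d: "\<And>n. 0 < d n" "d \<longlonglongrightarrow> 0"
  shows "(\<lambda>n. LINT x|lborel. complex_of_real (- 48 * ((d n)\<^sup>2)\<^sup>2 / ((norm (x - y))\<^sup>2 + (d n)\<^sup>2) ^ 4) * \<eta> x)
    \<longlonglongrightarrow> - complex_of_real (8 * pi\<^sup>2) * \<eta> y"
proof -
  have [measurable]: "\<eta> \<in> borel_measurable borel"
    by (rule borel_measurable_continuous_onI[OF c])
  obtain B where B: "0 \<le> B" "\<And>x. norm (\<eta> x) \<le> B"
    by (rule continuous_cball_bounded[OF c supp]) auto
  define k where "k z = 1 / (1 + (norm z)\<^sup>2) ^ 4" for z :: R4
  have k0: "0 \<le> k z" for z by (simp add: k_def)
  have [measurable]: "k \<in> borel_measurable borel" unfolding k_def[abs_def] by measurable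
  have dim: "DIM(R4) = 4" by simp
  have sub: "(LINT x|lborel. complex_of_real (- 48 * ((d n)\<^sup>2)\<^sup>2 / ((norm (x - y))\<^sup>2 + (d n)\<^sup>2) ^ 4) * \<eta> x)
     = (LINT z|lborel. complex_of_real (- 48 * k z) * \<eta> (y + d n *\<^sub>R z))" for n
  proof -
    have eq: "(d n) ^ 4 * (- 48 * ((d n)\<^sup>2)\<^sup>2 / ((norm (y + d n *\<^sub>R z - y))\<^sup>2 + (d n)\<^sup>2) ^ 4) = - 48 * k z" for z
    proof -
      have e1: "(norm (y + d n *\<^sub>R z - y))\<^sup>2 + (d n)\<^sup>2 = (d n)\<^sup>2 * (1 + (norm z)\<^sup>2)"
        using d(1)[of n] by (simp add: power_mult_distrib algebra_simps)
      have e2: "((d n)\<^sup>2 * (1 + (norm z)\<^sup>2)) ^ 4 = ((d n) ^ 4 * ((d n)\<^sup>2)\<^sup>2) * (1 + (norm z)\<^sup>2) ^ 4"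
        by (simp add: power_mult_distrib flip: power_mult power_add)
      have e3: "a * (- 48 * b / (a * b * W)) = - 48 * (1 / W)" if "a \<noteq> 0" "b \<noteq> 0" for a b W :: real
        using that by simp
      show ?thesis
        unfolding k_def e1 e2 by (rule e3) (use d(1)[of n] in auto)
    qed
    have "(LINT x|lborel. complex_of_real (- 48 * ((d n)\<^sup>2)\<^sup>2 / ((norm (x - y))\<^sup>2 + (d n)\<^sup>2) ^ 4) * \<eta> x)
     = (LINT z|lborel. ((d n) ^ 4) *\<^sub>R (complex_of_real (- 48 * ((d n)\<^sup>2)\<^sup>2 / ((norm (y + d n *\<^sub>R z - y))\<^sup>2 + (d n)\<^sup>2) ^ 4) * \<eta> (y + d n *\<^sub>R z)))"
      by (rule lborel_integral_affine[where 'a = R4, unfolded dim, OF _ d(1)]) measurable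
    also have "\<dots> = (LINT z|lborel. complex_of_real (- 48 * k z) * \<eta> (y + d n *\<^sub>R z))"
      unfolding eq[symmetric] scaleR_conv_of_real of_real_mult by (simp only: mult.assoc)
    finally show ?thesis .
  qed
  have ki: "integrable lborel k" "(LINT z|lborel. k z) = pi\<^sup>2 / 6"
    using biharmonic_profile_integral by (auto simp: k_def[abs_def])
  have "(\<lambda>n. LINT z|lborel. complex_of_real (- 48 * k z) * \<eta> (y + d n *\<^sub>R z)) \<longlonglongrightarrow> (LINT z|lborel. complex_of_real (- 48 * k z) * \<eta> y)"
  proof (rule integral_dominated_convergence)
    show "integrable lborel (\<lambda>z. 48 * B * k z)" using ki by simp
    show "AE z in lborel. (\<lambda>n. complex_of_real (- 48 * k z) * \<eta> (y + d n *\<^sub>R z)) \<longlonglongrightarrow> complex_of_real (- 48 * k z) * \<eta> y"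
    proof (rule AE_I2)
      fix z :: R4
      have "(\<lambda>n. y + d n *\<^sub>R z) \<longlonglongrightarrow> y + 0 *\<^sub>R z" by (intro tendsto_intros d)
      moreover have "isCont \<eta> y" using c continuous_on_eq_continuous_at by blast
      ultimately have "(\<lambda>n. \<eta> (y + d n *\<^sub>R z)) \<longlonglongrightarrow> \<eta> y"
        using isCont_tendsto_compose[of y \<eta>] by simp
      then show "(\<lambda>n. complex_of_real (- 48 * k z) * \<eta> (y + d n *\<^sub>R z)) \<longlonglongrightarrow> complex_of_real (- 48 * k z) * \<eta> y"
        by (intro tendsto_intros)
    qed
    show "AE z in lborel. norm (complex_of_real (- 48 * k z) * \<eta> (y + d n *\<^sub>R z)) \<le> 48 * B * k z" for n
    proof (rule AE_I2)
      fix z :: R4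
      have "48 * k z * norm (\<eta> (y + d n *\<^sub>R z)) \<le> 48 * k z * B"
        using B k0 by (intro mult_left_mono) auto
      then show "norm (complex_of_real (- 48 * k z) * \<eta> (y + d n *\<^sub>R z)) \<le> 48 * B * k z"
        using k0[of z] unfolding norm_mult norm_of_real by (simp add: mult_ac)
    qed
  qed measurable
  also have "(LINT z|lborel. complex_of_real (- 48 * k z) * \<eta> y) = - complex_of_real (8 * pi\<^sup>2) * \<eta> y"
  proof -
    have "(LINT z|lborel. complex_of_real (- 48 * k z)) = complex_of_real (- 48 * (pi\<^sup>2 / 6))"
      unfolding integral_complex_of_real integral_mult_right_zero ki(2) ..
    then show ?thesis by simp
  qed
  finally show ?thesis unfolding sub .
qed

lemma test_function_support:
  assumes "test_function \<eta>"
  obtains R where "\<And>x. x \<notin> cball 0 R \<Longrightarrow> \<eta> x = 0"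
proof -
  have "bounded {x. \<eta> x \<noteq> 0}"
    using assms bounded_subset[OF compact_imp_bounded closure_subset] by (auto simp: test_function_def)
  then obtain R where "\<And>x. \<eta> x \<noteq> 0 \<Longrightarrow> norm x \<le> R"
    unfolding bounded_iff by auto
  then show ?thesis by (intro that[of R]) fastforce
qed

text \<open>For \<open>d n \<le> 1\<close> the regularized logarithm lies between \<open>ln |x - y|\<close> and
  \<open>ln (jap (x - y))\<close>, which provides the integrable majorant.\<close>
lemma regularized_log_tendsto:
  fixes g :: "R4 \<Rightarrow> complex"
  assumes c: "continuous_on UNIV g" and supp: "\<And>x. x \<notin> cball 0 R \<Longrightarrow> g x = 0"
    and d: "\<And>n. 0 < d n" "\<And>n. d n \<le> 1" "d \<longlonglongrightarrow> 0"
  shows "(\<lambda>n. LINT x|lborel. complex_of_real (ln ((norm (x - y))\<^sup>2 + (d n)\<^sup>2) / 2) * g x)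
    \<longlonglongrightarrow> (LINT x|lborel. complex_of_real (ln (norm (y - x))) * g x)"
proof (rule integral_dominated_convergence)
  have [measurable]: "g \<in> borel_measurable borel"
    by (rule borel_measurable_continuous_onI[OF c])
  show "(\<lambda>x. complex_of_real (ln (norm (y - x))) * g x) \<in> borel_measurable lborel" by measurable
  show "(\<lambda>x. complex_of_real (ln ((norm (x - y))\<^sup>2 + (d n)\<^sup>2) / 2) * g x) \<in> borel_measurable lborel" for n by measurable
  obtain M where M: "log_bounded g M" using log_bounded_continuous_cball[OF c supp] by blast
  have "integrable lebesgue (\<lambda>x. complex_of_real (ln (norm (y - x))) * g x)"
    by (rule log_bounded_integral(1)[OF M log_norm_measurable abs_log_le])
      (use ln_ge_zero[OF jap_ge_1, of y] in simp)
  then have i1: "integrable lborel (\<lambda>x. complex_of_real (ln (norm (y - x))) * g x)"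
    by (simp add: integrable_completion)
  have i2: "integrable lborel (\<lambda>x. complex_of_real (ln (jap (x - y))) * g x)"
  proof (rule integrable_continuous_cball)
    have "continuous_on UNIV (\<lambda>x. ln (jap (x - y)))"
      unfolding jap_def by (intro continuous_intros) (auto simp: add_nonneg_eq_0_iff)
    then show "continuous_on UNIV (\<lambda>x. complex_of_real (ln (jap (x - y))) * g x)"
      by (intro continuous_on_mult continuous_on_of_real c)
  qed (use supp in auto)
  show "integrable lborel (\<lambda>x. norm (complex_of_real (ln (norm (y - x))) * g x) + norm (complex_of_real (ln (jap (x - y))) * g x))"
    using i1 i2 by (intro Bochner_Integration.integrable_add integrable_norm)
  have "AE x in lborel. x \<noteq> y" by (rule AE_lborel_singleton)
  then show "AE x in lborel. (\<lambda>n. complex_of_real (ln ((norm (x - y))\<^sup>2 + (d n)\<^sup>2) / 2) * g x) \<longlonglongrightarrow> complex_of_real (ln (norm (y - x))) * g x"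
  proof eventually_elim
    case (elim x)
    then have p: "0 < norm (x - y)" by simp
    have "(\<lambda>n. ln ((norm (x - y))\<^sup>2 + (d n)\<^sup>2) / 2) \<longlonglongrightarrow> ln ((norm (x - y))\<^sup>2 + 0\<^sup>2) / 2"
      using p by (intro tendsto_intros d) auto
    also have "ln ((norm (x - y))\<^sup>2 + 0\<^sup>2) / 2 = ln (norm (y - x))"
      using p by (simp add: ln_realpow norm_minus_commute)
    finally show ?case by (intro tendsto_intros)
  qed
  from \<open>AE x in lborel. x \<noteq> y\<close>
  show "AE x in lborel. norm (complex_of_real (ln ((norm (x - y))\<^sup>2 + (d n)\<^sup>2) / 2) * g x)
     \<le> norm (complex_of_real (ln (norm (y - x))) * g x) + norm (complex_of_real (ln (jap (x - y))) * g x)" for n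
  proof eventually_elim
    case (elim x)
    define r where "r = norm (x - y)"
    have r: "0 < r" using elim by (simp add: r_def)
    have "ln r = ln (r\<^sup>2) / 2" using r by (simp add: ln_realpow)
    also have "\<dots> \<le> ln (r\<^sup>2 + (d n)\<^sup>2) / 2"
      using r by (intro divide_right_mono ln_mono) (auto simp: add_pos_nonneg)
    finally have lo: "ln r \<le> ln (r\<^sup>2 + (d n)\<^sup>2) / 2" .
    have "(d n)\<^sup>2 \<le> 1" using d(1,2)[of n] by (simp add: power_le_one)
    then have "ln (r\<^sup>2 + (d n)\<^sup>2) / 2 \<le> ln (1 + r\<^sup>2) / 2"
      using r by (simp add: add_pos_nonneg)
    also have "\<dots> = ln (jap (x - y))"
      unfolding jap_def r_def by (simp add: ln_sqrt add_pos_nonneg)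
    finally have "\<bar>ln (r\<^sup>2 + (d n)\<^sup>2) / 2\<bar> \<le> \<bar>ln r\<bar> + \<bar>ln (jap (x - y))\<bar>"
      using lo by linarith
    then have "\<bar>ln (r\<^sup>2 + (d n)\<^sup>2) / 2\<bar> * norm (g x) \<le> (\<bar>ln r\<bar> + \<bar>ln (jap (x - y))\<bar>) * norm (g x)"
      by (rule mult_right_mono) simp
    then show ?case
      unfolding norm_mult norm_of_real r_def norm_minus_commute[of y x] by (simp only: distrib_right)
  qed
qed

text \<open>The kernel of \<^const>\<open>G1\<close> is a fundamental solution of
  \<open>\<Delta>\<^sup>2\<close>. The logarithm is regularized, both Laplacians are moved onto it
  by Green's identity, and the regularization is removed on both sides.\<close>
lemma G1_bilaplacian:
  assumes \<eta>: "test_function \<eta>"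
  shows "G1 (laplacian (laplacian \<eta>)) y = \<eta> y"
proof -
  obtain R where R: "\<And>x. x \<notin> cball 0 R \<Longrightarrow> \<eta> x = 0" using test_function_support[OF \<eta>] by blast
  have ck: "Ck k \<eta>" for k using \<eta> by (simp add: test_function_def)
  have ckl: "Ck k (laplacian \<eta>)" "Ck k (laplacian (laplacian \<eta>))" for k
    using Ck_laplacian ck by blast+
  have Rl: "laplacian \<eta> x = 0" "laplacian (laplacian \<eta>) x = 0" if "x \<notin> cball 0 R" for x
    using laplacian_outside[of R] R that by blast+
  have c: "continuous_on UNIV \<eta>" "continuous_on UNIV (laplacian (laplacian \<eta>))"
    using Ck_imp_continuous ck ckl by blast+
  have [measurable]: "laplacian (laplacian \<eta>) \<in> borel_measurable borel"
    by (rule borel_measurable_continuous_onI[OF c(2)])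
  define d where "d n = inverse (real (Suc n))" for n
  have d: "0 < d n" "d n \<le> 1" for n by (auto simp: d_def field_simps)
  have d0: "d \<longlonglongrightarrow> 0" unfolding d_def by (rule LIMSEQ_inverse_real_of_nat)
  have eq: "(LINT x|lborel. complex_of_real (ln ((norm (x - y))\<^sup>2 + (d n)\<^sup>2) / 2) * laplacian (laplacian \<eta>) x)
     = (LINT x|lborel. complex_of_real (- 48 * ((d n)\<^sup>2)\<^sup>2 / ((norm (x - y))\<^sup>2 + (d n)\<^sup>2) ^ 4) * \<eta> x)" for n
  proof -
    have "0 < (d n)\<^sup>2" using d(1)[of n] by simp
    note u = bilaplacian_regularized_log[OF this, of y]
    show ?thesis
      unfolding u(3)[symmetric]
      by (rule trans[OF green_identity[OF u(1) ckl(1) Rl(1)] green_identity[OF u(2) ck R]])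
  qed
  have "(LINT x|lborel. complex_of_real (ln (norm (y - x))) * laplacian (laplacian \<eta>) x) = - complex_of_real (8 * pi\<^sup>2) * \<eta> y"
  proof (rule LIMSEQ_unique)
    show "(\<lambda>n. LINT x|lborel. complex_of_real (ln ((norm (x - y))\<^sup>2 + (d n)\<^sup>2) / 2) * laplacian (laplacian \<eta>) x)
       \<longlonglongrightarrow> (LINT x|lborel. complex_of_real (ln (norm (y - x))) * laplacian (laplacian \<eta>) x)"
      by (rule regularized_log_tendsto[OF c(2) Rl(2) d d0])
    show "(\<lambda>n. LINT x|lborel. complex_of_real (ln ((norm (x - y))\<^sup>2 + (d n)\<^sup>2) / 2) * laplacian (laplacian \<eta>) x)
       \<longlonglongrightarrow> - complex_of_real (8 * pi\<^sup>2) * \<eta> y"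
      unfolding eq by (rule biharmonic_approximate_identity[OF c(1) R d(1) d0])
  qed
  then show ?thesis
    by (subst G1_borel_eq) auto
qed

section \<open>The kernel of QTQ\<close>

lemma decays_imp_square_integrable:
  assumes w: "decays 2 w" and [measurable]: "w \<in> borel_measurable lebesgue"
  shows "integrable lebesgue (\<lambda>x. (w x)\<^sup>2)"
proof -
  obtain M where M: "\<And>x. (\<integral>\<^sup>+y. ennreal ((log_kernel x y * w y)\<^sup>2) \<partial>lborel) \<le> ennreal M"
    using log_kernel_weighted_L2[OF w] by blast
  have "(\<integral>\<^sup>+y. ennreal (norm ((w y)\<^sup>2)) \<partial>lebesgue) \<le> (\<integral>\<^sup>+y. ennreal ((log_kernel 0 y * w y)\<^sup>2) \<partial>lebesgue)"
  proof (rule nn_integral_mono)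
    fix y
    have "1\<^sup>2 \<le> (log_kernel 0 y)\<^sup>2" by (intro power_mono log_kernel_ge_1) auto
    then have "1 * (w y)\<^sup>2 \<le> (log_kernel 0 y)\<^sup>2 * (w y)\<^sup>2" by (intro mult_right_mono) auto
    then show "ennreal (norm ((w y)\<^sup>2)) \<le> ennreal ((log_kernel 0 y * w y)\<^sup>2)"
      by (intro ennreal_leI) (simp add: power_mult_distrib)
  qed
  also have "\<dots> < \<infinity>"
    using M[of 0] by (simp add: nn_integral_completion le_less_trans)
  finally show ?thesis by (intro integrableI_bounded) auto
qed

lemma log_growth_weight_square_integrable:
  assumes w: "decays 2 w" and [measurable]: "w \<in> borel_measurable lebesgue"
  shows "integrable lebesgue (\<lambda>x. ((ln (jap x) + 1) * w x)\<^sup>2)"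
proof -
  have [measurable]: "jap \<in> borel_measurable lebesgue"
    by (rule borel_imp_lebesgue_measurable) measurable
  obtain M where M: "\<And>x. (\<integral>\<^sup>+y. ennreal ((log_kernel x y * w y)\<^sup>2) \<partial>lborel) \<le> ennreal M"
    using log_kernel_weighted_L2[OF w] by blast
  have "(\<integral>\<^sup>+y. ennreal (norm (((ln (jap y) + 1) * w y)\<^sup>2)) \<partial>lebesgue) \<le> (\<integral>\<^sup>+y. ennreal ((log_kernel 0 y * w y)\<^sup>2) \<partial>lebesgue)"
  proof (rule nn_integral_mono)
    fix y
    have "ln (jap y) \<le> ln (2 + norm y)"
      using jap_le[of y] jap_pos[of y] by (intro ln_mono) auto
    then have "ln (jap y) + 1 \<le> log_kernel 0 y" by (simp add: log_kernel_def)
    then have "(ln (jap y) + 1)\<^sup>2 \<le> (log_kernel 0 y)\<^sup>2"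
      using ln_ge_zero[OF jap_ge_1, of y] by (intro power_mono) auto
    then have "(ln (jap y) + 1)\<^sup>2 * (w y)\<^sup>2 \<le> (log_kernel 0 y)\<^sup>2 * (w y)\<^sup>2" by (intro mult_right_mono) auto
    then show "ennreal (norm (((ln (jap y) + 1) * w y)\<^sup>2)) \<le> ennreal ((log_kernel 0 y * w y)\<^sup>2)"
      by (intro ennreal_leI) (simp add: power_mult_distrib)
  qed
  also have "\<dots> < \<infinity>"
    using M[of 0] by (simp add: nn_integral_completion le_less_trans)
  finally show ?thesis by (intro integrableI_bounded) auto
qed

lemma Lp_2_add:
  assumes f: "f \<in> Lp 2" and g: "g \<in> Lp 2"
  shows "(\<lambda>x. f x + g x) \<in> Lp 2"
proof -
  have [measurable]: "f \<in> borel_measurable lebesgue" "g \<in> borel_measurable lebesgue"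
    and i: "integrable lebesgue (\<lambda>x. (norm (f x))\<^sup>2)" "integrable lebesgue (\<lambda>x. (norm (g x))\<^sup>2)"
    using f g by (auto simp: Lp_2_iff)
  have "integrable lebesgue (\<lambda>x. 2 * (norm (f x))\<^sup>2 + 2 * (norm (g x))\<^sup>2)"
    using i by auto
  then have "integrable lebesgue (\<lambda>x. (norm (f x + g x))\<^sup>2)"
  proof (rule Bochner_Integration.integrable_bound)
    show "AE x in lebesgue. norm ((norm (f x + g x))\<^sup>2) \<le> norm (2 * (norm (f x))\<^sup>2 + 2 * (norm (g x))\<^sup>2)"
    proof (rule AE_I2)
      fix x
      have "(norm (f x + g x))\<^sup>2 \<le> (norm (f x) + norm (g x))\<^sup>2"
        by (intro power_mono norm_triangle_ineq) auto
      also have "\<dots> \<le> 2 * (norm (f x))\<^sup>2 + 2 * (norm (g x))\<^sup>2"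
        using sum_squares_bound[of "norm (f x)" "norm (g x)"] by (simp add: power2_sum)
      finally show "norm ((norm (f x + g x))\<^sup>2) \<le> norm (2 * (norm (f x))\<^sup>2 + 2 * (norm (g x))\<^sup>2)"
        by simp
    qed
  qed measurable
  then show ?thesis by (simp add: Lp_2_iff)
qed

lemma Lp_2_AE:
  assumes f: "f \<in> Lp 2" and [measurable]: "g \<in> borel_measurable lebesgue" and ae: "f =ae g"
  shows "g \<in> Lp 2"
proof -
  have [measurable]: "f \<in> borel_measurable lebesgue" and i: "integrable lebesgue (\<lambda>x. (norm (f x))\<^sup>2)"
    using f by (auto simp: Lp_2_iff)
  have "integrable lebesgue (\<lambda>x. (norm (g x))\<^sup>2)"
    using i by (rule integrable_cong_AE_imp) (use ae in \<open>auto elim: eventually_mono\<close>)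
  then show ?thesis by (simp add: Lp_2_iff)
qed

text \<open>The potential grows at most logarithmically and \<open>v\<close> times a logarithm is still square
  integrable. This membership is what allows the projection \<open>P\<close>, which is specified on
  \<open>L\<^sup>2\<close> only, to be applied to \<open>T f\<close>.\<close>
lemma T_op_Lp_2:
  assumes V [measurable]: "V \<in> borel_measurable lebesgue" and v: "decays 2 (pot_v V)" and f: "f \<in> Lp 2"
  shows "T_op V f \<in> Lp 2"
proof -
  have [measurable]: "pot_v V \<in> borel_measurable lebesgue" "pot_U V \<in> borel_measurable lebesgue"
    unfolding pot_v_def[abs_def] pot_U_def[abs_def] by measurable
  have [measurable]: "f \<in> borel_measurable lebesgue" and fi: "integrable lebesgue (\<lambda>x. (norm (f x))\<^sup>2)"
    using f by (auto simp: Lp_2_iff)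
  obtain M where M: "log_bounded (mult_op (pot_v V) f) M"
    using log_bounded_weight[OF v _ f] by (auto simp: mult_op_def[abs_def])
  have M0: "0 \<le> M" using M by (simp add: log_bounded_def)
  have [measurable]: "G1 (mult_op (pot_v V) f) \<in> borel_measurable lebesgue"
    by (rule borel_imp_lebesgue_measurable[OF G1_measurable]) (use M in \<open>simp add: log_bounded_def\<close>)
  have "norm (mult_op (pot_U V) f x) = norm (f x)" for x
    by (simp add: mult_op_def pot_U_def norm_mult)
  then have 1: "mult_op (pot_U V) f \<in> Lp 2"
    using fi by (simp add: Lp_2_iff) (simp add: mult_op_def[abs_def])
  have "integrable lebesgue (\<lambda>x. M\<^sup>2 * ((ln (jap x) + 1) * pot_v V x)\<^sup>2)"
    using log_growth_weight_square_integrable[OF v] by simp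
  then have "integrable lebesgue (\<lambda>x. (norm (mult_op (pot_v V) (G1 (mult_op (pot_v V) f)) x))\<^sup>2)"
  proof (rule Bochner_Integration.integrable_bound)
    show "AE x in lebesgue. norm ((norm (mult_op (pot_v V) (G1 (mult_op (pot_v V) f)) x))\<^sup>2) \<le> norm (M\<^sup>2 * ((ln (jap x) + 1) * pot_v V x)\<^sup>2)"
    proof (rule AE_I2)
      fix x
      have "norm (mult_op (pot_v V) (G1 (mult_op (pot_v V) f)) x) \<le> \<bar>pot_v V x\<bar> * ((ln (jap x) + 1) * M)"
        unfolding mult_op_def[of _ "G1 _"] norm_mult norm_of_real by (intro mult_left_mono G1_log_growth M) auto
      from power_mono[OF this norm_ge_zero, of 2]
      show "norm ((norm (mult_op (pot_v V) (G1 (mult_op (pot_v V) f)) x))\<^sup>2) \<le> norm (M\<^sup>2 * ((ln (jap x) + 1) * pot_v V x)\<^sup>2)"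
        by (simp add: power_mult_distrib mult_ac)
    qed
  qed (simp add: mult_op_def[of _ "G1 _"])
  then have 2: "mult_op (pot_v V) (G1 (mult_op (pot_v V) f)) \<in> Lp 2"
    by (simp add: Lp_2_iff) (simp add: mult_op_def[of _ "G1 _", abs_def])
  show ?thesis unfolding T_op_def[abs_def] by (rule Lp_2_add[OF 1 2])
qed

text \<open>Testing orthogonality against \<open>v\<close> itself identifies the coefficient of the projection,
  because \<open>v\<^sup>2 = |V|\<close>.\<close>
lemma projection_onto_span_v:
  assumes V [measurable]: "V \<in> borel_measurable lebesgue" and v: "decays 2 (pot_v V)"
    and P: "orthogonal_projection P (span_v V)" and f: "f \<in> Lp 2"
  shows "\<exists>c. P f =ae (\<lambda>x. c * complex_of_real (pot_v V x))
           \<and> c * complex_of_real (LINT x|lebesgue. \<bar>V x\<bar>) = (LINT x|lebesgue. complex_of_real (pot_v V x) * f x)"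
    and "P f \<in> Lp 2"
    and "(LINT x|lebesgue. complex_of_real (pot_v V x) * (f x - P f x)) = 0"
proof -
  have vm [measurable]: "pot_v V \<in> borel_measurable lebesgue"
    unfolding pot_v_def[abs_def] by measurable
  have v2: "(pot_v V x)\<^sup>2 = \<bar>V x\<bar>" for x by (simp add: pot_v_def)
  have vi: "integrable lebesgue (\<lambda>x. \<bar>V x\<bar>)"
    using decays_imp_square_integrable[OF v vm] by (simp add: v2)
  have vL: "(\<lambda>x. complex_of_real (pot_v V x)) \<in> Lp 2"
    using vi by (simp add: Lp_2_iff v2)
  have vs: "(\<lambda>x. complex_of_real (pot_v V x)) \<in> span_v V"
    unfolding span_v_def using vL by (auto intro!: exI[of _ 1])
  have Ps: "P f \<in> span_v V" and orth: "ip (\<lambda>x. complex_of_real (pot_v V x)) (\<lambda>x. f x - P f x) = 0"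
    using P f vs by (auto simp: orthogonal_projection_def)
  show PL: "P f \<in> Lp 2" using Ps by (simp add: span_v_def)
  obtain c where c: "P f =ae (\<lambda>x. c * complex_of_real (pot_v V x))"
    using Ps by (auto simp: span_v_def)
  have [measurable]: "f \<in> borel_measurable lebesgue" "P f \<in> borel_measurable lebesgue"
    using f PL by (auto simp: Lp_2_iff)
  show zero: "(LINT x|lebesgue. complex_of_real (pot_v V x) * (f x - P f x)) = 0"
    using orth by (simp add: ip_def)
  have fi: "integrable lebesgue (\<lambda>x. complex_of_real (pot_v V x) * f x)"
    using log_bounded_weight[OF v vm f] log_bounded_integrable by blast
  have "(LINT x|lebesgue. complex_of_real (pot_v V x) * (f x - P f x))
      = (LINT x|lebesgue. complex_of_real (pot_v V x) * f x - c * complex_of_real \<bar>V x\<bar>)"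
  proof (rule integral_cong_AE)
    show "AE x in lebesgue. complex_of_real (pot_v V x) * (f x - P f x) = complex_of_real (pot_v V x) * f x - c * complex_of_real \<bar>V x\<bar>"
      using c
    proof eventually_elim
      case (elim x)
      have "complex_of_real (pot_v V x) * complex_of_real (pot_v V x) = complex_of_real \<bar>V x\<bar>"
        using v2[of x] by (simp add: power2_eq_square flip: of_real_mult)
      then show ?case unfolding elim by (simp add: right_diff_distrib mult.left_commute[of _ c])
    qed
  qed measurable
  also have "\<dots> = (LINT x|lebesgue. complex_of_real (pot_v V x) * f x) - c * complex_of_real (LINT x|lebesgue. \<bar>V x\<bar>)"
    using fi vi by (subst Bochner_Integration.integral_diff) (auto intro: integrable_of_real)
  finally have "c * complex_of_real (LINT x|lebesgue. \<bar>V x\<bar>) = (LINT x|lebesgue. complex_of_real (pot_v V x) * f x)"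
    using zero by simp
  with c show "\<exists>c. P f =ae (\<lambda>x. c * complex_of_real (pot_v V x))
           \<and> c * complex_of_real (LINT x|lebesgue. \<bar>V x\<bar>) = (LINT x|lebesgue. complex_of_real (pot_v V x) * f x)"
    by blast
qed

lemma integral_abs_potential_pos:
  assumes [measurable]: "V \<in> borel_measurable lebesgue" and nz: "\<not> (AE x in lebesgue. V x = 0)" and v: "decays 2 (pot_v V)"
  shows "0 < (LINT x|lebesgue. \<bar>V x\<bar>)"
proof -
  have "pot_v V \<in> borel_measurable lebesgue"
    unfolding pot_v_def[abs_def] by measurable
  from decays_imp_square_integrable[OF v this]
  have vi: "integrable lebesgue (\<lambda>x. \<bar>V x\<bar>)" by (simp add: pot_v_def)
  have "(LINT x|lebesgue. \<bar>V x\<bar>) \<noteq> 0"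
    using nz by (subst integral_nonneg_eq_0_iff_AE[OF vi]) auto
  moreover have "0 \<le> (LINT x|lebesgue. \<bar>V x\<bar>)" by simp
  ultimately show ?thesis by linarith
qed

text \<open>Elements of \<open>Q L\<^sup>2\<close> are orthogonal to \<open>v\<close>, so \<open>Q\<close> acts
  on them as the identity up to null sets, and \<open>Q T f = 0\<close> says that \<open>T f\<close>
  is a multiple of \<open>v\<close>. The function \<open>P f\<close> vanishes only almost
  everywhere, which is why \<open>T f\<close> is compared with \<open>T (Q f)\<close> before the
  projection is applied.\<close>
lemma ker_QTQ_characterization:
  assumes V [measurable]: "V \<in> borel_measurable lebesgue" and nz: "\<not> (AE x in lebesgue. V x = 0)"
    and v: "decays 2 (pot_v V)" and P: "orthogonal_projection P (span_v V)"
    and f: "f \<in> ker_QTQ V P"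
    and c0: "c0 = complex_of_real (1 / (LINT x|lebesgue. \<bar>V x\<bar>)) * (LINT x|lebesgue. complex_of_real (pot_v V x) * T_op V f x)"
  shows "f \<in> Lp 2"
    and "(LINT x|lebesgue. complex_of_real (pot_v V x) * f x) = 0"
    and "T_op V f =ae (\<lambda>x. c0 * complex_of_real (pot_v V x))"
proof -
  note Pv = projection_onto_span_v[OF V v P]
  have N: "0 < (LINT x|lebesgue. \<bar>V x\<bar>)" by (rule integral_abs_potential_pos[OF V nz v])
  have [measurable]: "pot_v V \<in> borel_measurable lebesgue" "pot_U V \<in> borel_measurable lebesgue"
    unfolding pot_v_def[abs_def] pot_U_def[abs_def] by measurable
  show fL: "f \<in> Lp 2" using f by (simp add: ker_QTQ_def range_L2_def)
  obtain h where h: "h \<in> Lp 2" and fh: "f =ae compl_proj P h"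
    and ker: "compl_proj P (T_op V (compl_proj P f)) =ae (\<lambda>x. 0)"
    using f by (auto simp: ker_QTQ_def range_L2_def)
  have [measurable]: "f \<in> borel_measurable lebesgue" "h \<in> borel_measurable lebesgue" "P h \<in> borel_measurable lebesgue" "P f \<in> borel_measurable lebesgue"
    using fL h Pv(2)[OF h] Pv(2)[OF fL] by (auto simp: Lp_2_iff)
  have "(LINT x|lebesgue. complex_of_real (pot_v V x) * f x) = (LINT x|lebesgue. complex_of_real (pot_v V x) * (h x - P h x))"
    by (rule integral_cong_AE) (use fh in \<open>auto simp: compl_proj_def elim: eventually_mono\<close>)
  then show mean: "(LINT x|lebesgue. complex_of_real (pot_v V x) * f x) = 0"
    using Pv(3)[OF h] by simp
  define f' where "f' = compl_proj P f"
  have [measurable]: "f' \<in> borel_measurable lebesgue"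
    unfolding f'_def compl_proj_def[abs_def] by measurable
  have ff': "f =ae f'"
  proof -
    obtain c where c: "P f =ae (\<lambda>x. c * complex_of_real (pot_v V x))"
      and "c * complex_of_real (LINT x|lebesgue. \<bar>V x\<bar>) = (LINT x|lebesgue. complex_of_real (pot_v V x) * f x)"
      using Pv(1)[OF fL] by blast
    then have "c = 0" using mean N by auto
    then show ?thesis using c by (auto simp: f'_def compl_proj_def elim: eventually_mono)
  qed
  have G: "G1 (mult_op (pot_v V) f') = G1 (mult_op (pot_v V) f)"
    by (rule G1_cong_AE; use ff' in \<open>auto simp: mult_op_def[abs_def] elim: eventually_mono\<close>)
  have TT: "T_op V f' =ae T_op V f"
    using ff' by eventually_elim (simp add: T_op_def G mult_op_def)
  have TL: "T_op V f \<in> Lp 2" "T_op V f' \<in> Lp 2"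
    using T_op_Lp_2[OF V v] fL Lp_2_AE[OF fL _ ff'] by auto
  then have [measurable]: "T_op V f \<in> borel_measurable lebesgue" "T_op V f' \<in> borel_measurable lebesgue"
    by (auto simp: Lp_2_iff)
  obtain c where c: "P (T_op V f') =ae (\<lambda>x. c * complex_of_real (pot_v V x))"
    and cN: "c * complex_of_real (LINT x|lebesgue. \<bar>V x\<bar>) = (LINT x|lebesgue. complex_of_real (pot_v V x) * T_op V f' x)"
    using Pv(1)[OF TL(2)] by blast
  have "(LINT x|lebesgue. complex_of_real (pot_v V x) * T_op V f' x) = (LINT x|lebesgue. complex_of_real (pot_v V x) * T_op V f x)"
    by (rule integral_cong_AE) (use TT in \<open>auto elim: eventually_mono\<close>)
  then have "c = c0" using cN N unfolding c0 by (simp add: field_simps)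
  have "compl_proj P (T_op V f') =ae (\<lambda>x. 0)" using ker by (simp add: f'_def)
  then show "T_op V f =ae (\<lambda>x. c0 * complex_of_real (pot_v V x))"
    using TT c by eventually_elim (simp add: compl_proj_def \<open>c = c0\<close>)
qed

section \<open>Distributional solutions and decay of the potential\<close>

lemma locally_integrable_bounded:
  assumes [measurable]: "f \<in> borel_measurable lebesgue" and B: "\<And>x. norm (f x) \<le> B"
  shows "locally_integrable f"
  unfolding locally_integrable_def set_integrable_def
proof (intro allI impI)
  fix K :: "R4 set" assume K: "compact K"
  have [measurable]: "K \<in> sets lebesgue"
    using K by (simp add: borel_compact)
  have "integrable lborel (indicator K :: R4 \<Rightarrow> real)"
    using K emeasure_compact_finite[OF K] by (intro integrable_real_indicator) (auto simp: borel_compact)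
  then have "integrable lebesgue (\<lambda>x. B * indicator K x :: real)"
    using K by (subst integrable_completion) (auto simp: borel_compact)
  then show "integrable lebesgue (\<lambda>x. indicat_real K x *\<^sub>R f x)"
  proof (rule Bochner_Integration.integrable_bound)
    show "AE x in lebesgue. norm (indicat_real K x *\<^sub>R f x) \<le> norm (B * indicator K x)"
      using B order_trans[OF norm_ge_zero B] by (intro AE_I2) (auto simp: indicator_def)
  qed measurable
qed

lemma locally_integrable_integrable:
  assumes "integrable lebesgue f"
  shows "locally_integrable f"
  unfolding locally_integrable_def set_integrable_def
  using assms by (auto intro!: integrable_mult_indicator simp: borel_compact)

text \<open>Constants are annihilated by \<open>\<Delta>\<^sup>2\<close>, and by the fundamental solution
  property \<open>\<Delta>\<^sup>2\<close> applied to the potential of \<open>F\<close> is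
  \<open>F\<close>; the hypothesis \<open>VF\<close> says that \<open>F\<close> is also
  \<open>V\<close> times \<open>c - G1 F\<close>, so the two terms of the equation cancel.\<close>
lemma H_zero_distr_potential:
  assumes F: "log_bounded F M" and mean: "(LINT y|lebesgue. F y) = 0"
    and V [measurable]: "V \<in> borel_measurable lebesgue"
    and VF: "mult_op V (\<lambda>x. c - G1 F x) =ae F"
  shows "H_zero_distr V (\<lambda>x. c - G1 F x)"
proof -
  have Fm [measurable]: "F \<in> borel_measurable lebesgue" using F by (simp add: log_bounded_def)
  have [measurable]: "G1 F \<in> borel_measurable lebesgue"
    by (rule borel_imp_lebesgue_measurable[OF G1_measurable[OF Fm]])
  have b: "norm (G1 F x) \<le> M" for x by (rule G1_mean_zero_bounded[OF F mean])
  have [measurable]: "mult_op V (\<lambda>x. c - G1 F x) \<in> borel_measurable lebesgue"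
    unfolding mult_op_def[abs_def] by measurable
  have Fi: "integrable lebesgue F" by (rule log_bounded_integrable[OF F])
  show ?thesis unfolding H_zero_distr_def
  proof (intro conjI allI impI)
    show "locally_integrable (\<lambda>x. c - G1 F x)"
      by (rule locally_integrable_bounded[of _ "norm c + M"])
        (use b in \<open>auto intro: order_trans[OF norm_triangle_ineq4]\<close>)
    have "integrable lebesgue (mult_op V (\<lambda>x. c - G1 F x))"
      using Fi by (rule integrable_cong_AE_imp) (use VF in \<open>auto elim: eventually_mono\<close>)
    then show "locally_integrable (mult_op V (\<lambda>x. c - G1 F x))"
      by (rule locally_integrable_integrable)
  next
    fix \<eta> assume \<eta>: "test_function \<eta>"
    define g where "g = laplacian (laplacian \<eta>)"
    obtain R where R: "\<And>x. x \<notin> cball 0 R \<Longrightarrow> \<eta> x = 0" using test_function_support[OF \<eta>] by blast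
    have ck: "Ck k \<eta>" for k using \<eta> by (simp add: test_function_def)
    have ckl: "Ck k (laplacian \<eta>)" "Ck k g" for k
      unfolding g_def using Ck_laplacian ck by blast+
    have Rl: "laplacian \<eta> x = 0" "g x = 0" if "x \<notin> cball 0 R" for x
      unfolding g_def using laplacian_outside[of R] R that by blast+
    have c: "continuous_on UNIV \<eta>" "continuous_on UNIV g"
      using Ck_imp_continuous ck ckl by blast+
    have gb [measurable]: "g \<in> borel_measurable borel" and \<eta>b: "\<eta> \<in> borel_measurable borel"
      using c by (auto intro: borel_measurable_continuous_onI)
    have [measurable]: "g \<in> borel_measurable lebesgue" "\<eta> \<in> borel_measurable lebesgue"
      by (rule borel_imp_lebesgue_measurable[OF gb], rule borel_imp_lebesgue_measurable[OF \<eta>b])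
    obtain B where B: "\<And>x. norm (g x) \<le> B * indicator (cball 0 R) x"
      using continuous_cball_bounded[OF c(2) Rl(2)] by blast
    have gi: "integrable lebesgue g"
      using integrable_continuous_cball[OF c(2) Rl(2)] by (simp add: integrable_completion)
    have "integrable lebesgue (\<lambda>x. M * norm (g x))" using gi by auto
    then have Gi: "integrable lebesgue (\<lambda>x. G1 F x * g x)"
      by (rule Bochner_Integration.integrable_bound)
        (auto simp: norm_mult abs_mult intro!: AE_I2 mult_right_mono order_trans[OF b] abs_ge_self)
    have "(LINT x|lebesgue. g x) = 0"
      using integral_laplacian_eq_0[OF ckl(1) Rl(1)] by (simp add: integral_completion flip: g_def)
    then have "(LINT x|lebesgue. (c - G1 F x) * g x) = - (LINT x|lebesgue. G1 F x * g x)"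
      using gi Gi by (simp add: left_diff_distrib)
    also have "(LINT x|lebesgue. G1 F x * g x) = (LINT y|lebesgue. F y * G1 g y)"
      by (rule G1_symmetric[OF F gb B])
    also have "\<dots> = (LINT y|lebesgue. F y * \<eta> y)"
      unfolding g_def G1_bilaplacian[OF \<eta>] ..
    also have "\<dots> = (LINT x|lebesgue. mult_op V (\<lambda>x. c - G1 F x) x * \<eta> x)"
      by (rule integral_cong_AE) (use VF in \<open>auto elim: eventually_mono\<close>)
    finally show "(LINT x|lebesgue. (c - G1 F x) * laplacian (laplacian \<eta>) x)
      + (LINT x|lebesgue. mult_op V (\<lambda>x. c - G1 F x) x * \<eta> x) = 0"
      by (simp add: g_def)
  qed
qed

lemma decays_jap:
  assumes "decays 3 w"
  shows "decays 2 (\<lambda>x. jap x * w x)"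
proof -
  obtain C e where C: "C > 0" "e > 0" and w: "AE x in lebesgue. \<bar>w x\<bar> \<le> C * jap x powr (- 3 - e)"
    using assms unfolding decays_def by blast
  have "AE x in lebesgue. \<bar>jap x * w x\<bar> \<le> C * jap x powr (- 2 - e)"
    using w
  proof eventually_elim
    case (elim x)
    have "\<bar>jap x * w x\<bar> \<le> jap x * (C * jap x powr (- 3 - e))"
      using elim jap_pos[of x] by (simp add: abs_mult)
    also have "\<dots> = C * (jap x powr 1 * jap x powr (- 3 - e))"
      using jap_pos[of x] by simp
    also have "jap x powr 1 * jap x powr (- 3 - e) = jap x powr (1 + (- 3 - e))"
      by (simp only: powr_add)
    also have "1 + (- 3 - e) = - 2 - e" by simp
    finally show ?case .
  qed
  then show ?thesis unfolding decays_def using C by blast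
qed

text \<open>The threshold 4 is the dimension: \<open>jap x powr -p\<close> is integrable precisely beyond it.\<close>
lemma Lp_of_jap_decay:
  assumes [measurable]: "f \<in> borel_measurable lebesgue" and b: "\<And>x. norm (f x) \<le> C / jap x" and p: "4 < p"
  shows "f \<in> Lp p"
proof (cases "p = \<infinity>")
  case True
  have "norm (f x) \<le> \<bar>C\<bar>" for x
  proof -
    have "C / jap x \<le> \<bar>C\<bar> / 1"
      using jap_ge_1[of x] by (intro frac_le) auto
    then show ?thesis using b[of x] by simp
  qed
  then show ?thesis using True by (auto simp: Lp_def)
next
  case False
  define r where "r = enn2real p"
  have "p = ennreal r" using False by (simp add: r_def less_top)
  then have r: "4 < r" using p by (simp add: r_def) (metis enn2real_nonneg ennreal_less_iff ennreal_numeral r_def zero_le_numeral)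
  have "integrable lborel (\<lambda>x. jap x powr - r)"
    using nn_integral_jap_powr_finite[OF r] by (intro integrableI_bounded) auto
  then have "integrable lebesgue (\<lambda>x. \<bar>C\<bar> powr r * jap x powr - r)"
    by (subst integrable_completion) auto
  then have "integrable lebesgue (\<lambda>x. norm (f x) powr r)"
  proof (rule Bochner_Integration.integrable_bound)
    show "AE x in lebesgue. norm (norm (f x) powr r) \<le> norm (\<bar>C\<bar> powr r * jap x powr - r)"
    proof (rule AE_I2)
      fix x
      have "norm (f x) \<le> \<bar>C\<bar> / jap x"
        using b[of x] divide_right_mono[of C "\<bar>C\<bar>" "jap x"] jap_pos[of x] by linarith
      then have "norm (f x) powr r \<le> (\<bar>C\<bar> / jap x) powr r"
        using r by (intro powr_mono2) auto
      also have "\<dots> = \<bar>C\<bar> powr r * jap x powr - r"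
        using jap_pos[of x] by (simp add: powr_divide powr_minus_divide)
      finally show "norm (norm (f x) powr r) \<le> norm (\<bar>C\<bar> powr r * jap x powr - r)" by simp
    qed
  qed measurable
  then show ?thesis using False by (simp add: Lp_def r_def)
qed

section \<open>The representation of elements of the kernel\<close>

theorem lemma7p1:
  fixes V :: "real^4 \<Rightarrow> real"
    and P S\<^sub>1 :: "(real^4 \<Rightarrow> complex) \<Rightarrow> (real^4 \<Rightarrow> complex)"
    and \<phi> :: "real^4 \<Rightarrow> complex"
  assumes V_meas: "V \<in> borel_measurable lebesgue"
    and V_nonzero: "\<not> (AE x in lebesgue. V x = 0)"
    and v_decay: "decays 2 (pot_v V)"
    and P_proj: "orthogonal_projection P (span_v V)"
    and S1_proj: "orthogonal_projection S\<^sub>1 (ker_QTQ V P)"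
    and phi_in: "\<phi> \<in> range_L2 S\<^sub>1"
    and phi_nonzero: "\<not> (\<phi> =ae (\<lambda>x. 0))"
  shows "(\<exists>c\<^sub>0 \<psi>.
            c\<^sub>0 = complex_of_real (1 / (LINT x|lebesgue. \<bar>V x\<bar>))
                  * ip (\<lambda>x. complex_of_real (pot_v V x)) (T_op V \<phi>)
          \<and> c\<^sub>0 = complex_of_real (1 / (LINT x|lebesgue. \<bar>V x\<bar>))
                  * (LINT x|lebesgue. complex_of_real (pot_v V x) * T_op V \<phi> x)
          \<and> \<psi> \<in> Lp \<infinity>
          \<and> \<phi> =ae mult_op (pot_U V) (mult_op (pot_v V) \<psi>)
          \<and> H_zero_distr V \<psi>
          \<and> \<psi> =ae (\<lambda>x. c\<^sub>0 - G1 (mult_op (pot_v V) \<phi>) x))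
       \<and> (decays 3 (pot_v V) \<longrightarrow>
            (\<forall>p::ennreal. 4 < p \<longrightarrow> G1 (mult_op (pot_v V) \<phi>) \<in> Lp p))"
proof -
  note [measurable] = V_meas
  have vm [measurable]: "pot_v V \<in> borel_measurable lebesgue" "pot_U V \<in> borel_measurable lebesgue"
    unfolding pot_v_def[abs_def] pot_U_def[abs_def] by measurable
  obtain f where f: "f \<in> ker_QTQ V P" and \<phi>f: "\<phi> =ae f" and \<phi>L: "\<phi> \<in> Lp 2"
    using phi_in S1_proj by (auto simp: range_L2_def orthogonal_projection_def)
  define c\<^sub>0 where "c\<^sub>0 = complex_of_real (1 / (LINT x|lebesgue. \<bar>V x\<bar>))
                  * (LINT x|lebesgue. complex_of_real (pot_v V x) * T_op V f x)"
  note ker = ker_QTQ_characterization[OF V_meas V_nonzero v_decay P_proj f c\<^sub>0_def]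
  have [measurable]: "\<phi> \<in> borel_measurable lebesgue" "f \<in> borel_measurable lebesgue"
    using \<phi>L ker(1) by (auto simp: Lp_2_iff)
  define F where "F = mult_op (pot_v V) \<phi>"
  obtain M where FM: "log_bounded F M"
    using log_bounded_weight[OF v_decay vm(1) \<phi>L] by (auto simp: F_def mult_op_def[abs_def])
  have mean: "(LINT y|lebesgue. F y) = 0"
  proof -
    have "(LINT y|lebesgue. F y) = (LINT y|lebesgue. complex_of_real (pot_v V y) * f y)"
      unfolding F_def mult_op_def
      by (rule integral_cong_AE) (use \<phi>f in \<open>auto elim: eventually_mono\<close>)
    then show ?thesis using ker(2) by simp
  qed
  have G: "G1 (mult_op (pot_v V) f) = G1 F"
    unfolding F_def by (rule G1_cong_AE; use \<phi>f in \<open>auto simp: mult_op_def[abs_def] elim: eventually_mono\<close>)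
  have TT: "T_op V \<phi> =ae T_op V f"
    using \<phi>f by eventually_elim (simp add: T_op_def G F_def mult_op_def)
  have Fm: "F \<in> borel_measurable lebesgue" using FM by (simp add: log_bounded_def)
  have Gm [measurable]: "G1 F \<in> borel_measurable lebesgue"
    by (rule borel_imp_lebesgue_measurable[OF G1_measurable[OF Fm]])
  have [measurable]: "T_op V \<phi> \<in> borel_measurable lebesgue" "T_op V f \<in> borel_measurable lebesgue"
    using T_op_Lp_2[OF V_meas v_decay] \<phi>L ker(1) by (auto simp: Lp_2_iff)
  have c0: "c\<^sub>0 = complex_of_real (1 / (LINT x|lebesgue. \<bar>V x\<bar>))
                  * (LINT x|lebesgue. complex_of_real (pot_v V x) * T_op V \<phi> x)"
  proof -
    have "(LINT x|lebesgue. complex_of_real (pot_v V x) * T_op V \<phi> x) = (LINT x|lebesgue. complex_of_real (pot_v V x) * T_op V f x)"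
      by (rule integral_cong_AE) (use TT in \<open>auto elim: eventually_mono\<close>)
    then show ?thesis by (simp add: c\<^sub>0_def)
  qed
  define \<psi> where "\<psi> x = c\<^sub>0 - G1 F x" for x
  have rep: "\<phi> =ae mult_op (pot_U V) (mult_op (pot_v V) \<psi>)"
    using TT ker(3)
  proof eventually_elim
    case (elim x)
    have "mult_op (pot_U V) \<phi> x + complex_of_real (pot_v V x) * G1 F x = c\<^sub>0 * complex_of_real (pot_v V x)"
      using elim by (simp add: T_op_def F_def mult_op_def)
    then have "complex_of_real (pot_U V x) * \<phi> x = complex_of_real (pot_v V x) * \<psi> x"
      by (simp add: mult_op_def \<psi>_def algebra_simps)
    \<comment> \<open>Since \<open>U\<^sup>2 = 1\<close>, multiplying \<open>U \<phi> = v \<psi>\<close> by \<open>U\<close> solves for \<open>\<phi>\<close>.\<close>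
    moreover have "complex_of_real (pot_U V x) * (complex_of_real (pot_U V x) * \<phi> x) = \<phi> x"
      by (simp add: pot_U_def)
    ultimately show ?case by (simp only: mult_op_def)
  qed
  have "mult_op V \<psi> =ae F"
    using rep
  proof eventually_elim
    case (elim x)
    have "V x = pot_v V x * (pot_U V x * pot_v V x)"
      by (simp add: pot_U_def pot_v_def abs_if)
    then have "complex_of_real (V x) = complex_of_real (pot_v V x) * (complex_of_real (pot_U V x) * complex_of_real (pot_v V x))"
      by (metis of_real_mult)
    then show ?case unfolding F_def mult_op_def[of _ \<phi>] elim by (simp add: mult_op_def)
  qed
  then have H: "H_zero_distr V \<psi>"
    unfolding \<psi>_def by (intro H_zero_distr_potential[OF FM mean V_meas])
  have "norm (\<psi> x) \<le> norm c\<^sub>0 + M" for x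
    unfolding \<psi>_def using G1_mean_zero_bounded[OF FM mean, of x] norm_triangle_ineq4[of c\<^sub>0 "G1 F x"] by linarith
  then have "\<psi> \<in> Lp \<infinity>"
    unfolding Lp_def by (auto simp: \<psi>_def[abs_def])
  moreover have "G1 F \<in> Lp p" if d3: "decays 3 (pot_v V)" and "4 < p" for p
  proof -
    have [measurable]: "jap \<in> borel_measurable lebesgue"
      by (rule borel_imp_lebesgue_measurable) measurable
    obtain M' where "log_bounded (\<lambda>x. complex_of_real (jap x * pot_v V x) * \<phi> x) M'"
      using log_bounded_weight[OF decays_jap[OF d3] _ \<phi>L] by auto
    then have "log_bounded (\<lambda>x. complex_of_real (jap x) * F x) M'"
      by (simp add: F_def mult_op_def mult.assoc)
    from G1_mean_zero_decay[OF FM mean this] show ?thesis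
      by (rule Lp_of_jap_decay[OF Gm _ \<open>4 < p\<close>])
  qed
  ultimately show ?thesis
    using c0 rep H unfolding F_def[symmetric]
    by (intro conjI exI[of _ c\<^sub>0] exI[of _ \<psi>]) (auto simp: ip_def \<psi>_def)
qed

end
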